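(* Let $0<\underline B<\overline B$ and $0<\underline\gamma<\overline\gamma$ be given. Let $K$ be a kernel such that: (i) there exists $C_K<\infty$ with $K(y,x)=0$ for $|x-y|>C_K$, and $K(y,x)=K(y-k,x-k)$ for all $k\in\mathbb{Z}$, $x,y\in\mathbb{R}$; (ii) $\sup_{t\in[0,1]}\int K(t,x)^2\,dx<\infty$ and there exists $\tau_K>0$ such that $\sup_{s,t\in[0,1]}\frac{\int[K(s,x)-K(t,x)]^2\,dx}{|s-t|^{\tau_K}}<\infty$; (iii) for some constant $\tilde C$, one has $\sup_{t\in[0,1]}|K_jf(t)-f(t)|\le\tilde CB2^{-j\gamma}$ for all integers $j$, all $f\in\mathcal{F}_{\text{H\"ol}}(\gamma,B)$, all $B\in[\underline B,\overline B]$ and all $\gamma\in[\underline\gamma,\overline\gamma]$. Then there exists a constant $C^*_{K,\overline\gamma,\tilde C}$ depending only on $K$, $\overline\gamma$ and $\tilde C$ such that, for each $\varepsilon>0$, there exists a confidence band $\mathcal{C}_n(\cdot)$ (a single band for each $n$, not depending on the unknown $\gamma$, $B$ or $f$) such that, with probability approaching one as $n\to\infty$ uniformly over $\bigcup_{\gamma\in[\underline\gamma,\overline\gamma]}\bigcup_{B\in[\underline B,\overline B]}\mathcal{F}_{\text{self-sim}}(\gamma,B,\varepsilon)$, $$\sup_{x\in[0,1]}\mathrm{length}(\mathcal{C}_n(x))\le C^*_{K,\overline\gamma,\tilde C}\,(B\varepsilon^{-1})^{1/(2\gamma+1)}\left(\sigma_n^2\log(1/\sigma_n^2)\right)^{\gamma/(2\gamma+1)}$$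 and $f(x)\in\mathcal{C}_n(x)$ for all $x\in[0,1]$. That is, the infimum, over $\gamma\in[\underline\gamma,\overline\gamma]$, $B\in[\underline B,\overline B]$ and $f\in\mathcal{F}_{\text{self-sim}}(\gamma,B,\varepsilon)$, of the $P_f$-probability that both of these hold tends to $1$ as $n\to\infty$.
   Context: White noise model: one observes $Y(t)=\int_0^t f(s)\,ds+\sigma_n W(t)$ for $t\in[-\eta,1+\eta]$ (some fixed $\eta>0$), where $f:\mathbb{R}\to\mathbb{R}$ is unknown, $W$ is a standard (two-sided) Brownian motion, and $\sigma_n=\sigma/\sqrt n$ is known, with $\sigma>0$ fixed. $P_f$ denotes probability when $Y$ is generated by $f$. H\"older class: for $\gamma,B>0$, with $\lfloor\gamma\rfloor$ the greatest integer strictly less than $\gamma$, $\mathcal{F}_{\text{H\"ol}}(\gamma,B)$ is the set of ($\lfloor\gamma\rfloor$ times differentiable) $f:\mathbb{R}\to\mathbb{R}$ with $|f^{(\lfloor\gamma\rfloor)}(t)-f^{(\lfloor\gamma\rfloor)}(t')|\le B|t-t'|^{\gamma-\lfloor\gamma\rfloor}$ for all $t,t'\in\mathbb{R}$. Kernel: a function $K:\mathbb{R}^2\to\mathbb{R}$ such that $x\mapsto K(t,x)$ is of bounded variation for each $t$. For an integer $j$, $K_j(t,x)=2^jK(2^jt,2^jx)$ and $K_jf(t)=\int K_j(t,x)f(x)\,dx$. Self-similarity class: fix $\underline j>0$. For $\gamma,B,\varepsilon>0$, $\mathcal{F}_{\text{self-sim}}(\gamma,B,\varepsilon)=\mathcal{F}_{\text{self-sim}}(\gamma,B,\varepsilon;K,\underline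 j)$ is the set of $f\in\mathcal{F}_{\text{H\"ol}}(\gamma,B)$ such that $\sup_{t\in[0,1]}|K_jf(t)-f(t)|\ge\varepsilon B2^{-j\gamma}$ for all integers $j\ge\underline j$. A confidence band $\mathcal{C}_n(\cdot)$ is a collection of random intervals $\mathcal{C}_n(x)=\mathcal{C}_n(x;Y)$, $x\in[0,1]$, depending on the data $Y$ observed at noise level $\sigma_n$. $\mathrm{length}(\mathcal{A})=\sup\mathcal{A}-\inf\mathcal{A}$. *)

theory Defs
  imports "HOL-Probability.Probability"
begin

section \<open>Function classes\<close>

text \<open>The greatest integer \<^emph>\<open>strictly\<close> less than \<open>\<gamma>\<close>; it is nonnegative for \<open>\<gamma> > 0\<close>.\<close>
definition strict_floor :: "real \<Rightarrow> nat" where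
  "strict_floor \<gamma> = nat (\<lceil>\<gamma>\<rceil> - 1)"

definition holder_class :: "real \<Rightarrow> real \<Rightarrow> (real \<Rightarrow> real) set" where
  "holder_class \<gamma> B = {f.
     (\<forall>i < strict_floor \<gamma>. \<forall>t. ((deriv ^^ i) f) differentiable (at t)) \<and>
     (\<forall>t t'. \<bar>(deriv ^^ strict_floor \<gamma>) f t - (deriv ^^ strict_floor \<gamma>) f t'\<bar>
               \<le> B * \<bar>t - t'\<bar> powr (\<gamma> - real (strict_floor \<gamma>)))}"

definition bounded_variation :: "(real \<Rightarrow> real) \<Rightarrow> bool" where
  "bounded_variation g \<longleftrightarrow>
     (\<exists>V. \<forall>(x :: nat \<Rightarrow> real) n. mono x \<longrightarrow> (\<Sum>i<n. \<bar>g (x (Suc i)) - g (x i)\<bar>) \<le> V)"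

definition is_kernel :: "(real \<Rightarrow> real \<Rightarrow> real) \<Rightarrow> bool" where
  "is_kernel K \<longleftrightarrow> (\<forall>t. bounded_variation (K t))"

definition kernel_scaled :: "(real \<Rightarrow> real \<Rightarrow> real) \<Rightarrow> int \<Rightarrow> real \<Rightarrow> real \<Rightarrow> real" where
  "kernel_scaled K j t x = 2 powi j * K (2 powi j * t) (2 powi j * x)"

definition kernel_approx ::
    "(real \<Rightarrow> real \<Rightarrow> real) \<Rightarrow> int \<Rightarrow> (real \<Rightarrow> real) \<Rightarrow> real \<Rightarrow> real" where
  "kernel_approx K j f t = (LINT x|lborel. kernel_scaled K j t x * f x)"

text \<open>Suprema are taken in \<^typ>\<open>ereal\<close>, so that an unbounded error has supremum \<open>\<infinity>\<close>.\<close>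
definition approx_error :: "(real \<Rightarrow> real \<Rightarrow> real) \<Rightarrow> int \<Rightarrow> (real \<Rightarrow> real) \<Rightarrow> ereal" where
  "approx_error K j f = (SUP t\<in>{0..1}. ereal \<bar>kernel_approx K j f t - f t\<bar>)"

definition self_similar_class ::
    "(real \<Rightarrow> real \<Rightarrow> real) \<Rightarrow> real \<Rightarrow> real \<Rightarrow> real \<Rightarrow> real \<Rightarrow> (real \<Rightarrow> real) set" where
  "self_similar_class K j0 \<gamma> B \<epsilon> = {f \<in> holder_class \<gamma> B.
     \<forall>j::int. of_int j \<ge> j0 \<longrightarrow> approx_error K j f \<ge> ereal (\<epsilon> * B * 2 powr (- (of_int j * \<gamma>)))}"


section \<open>White noise model\<close>

text \<open>Standard two-sided Brownian motion \<open>W\<close> (time first, then the sample point), on the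
  probability space \<open>M\<close>.  Independence of the increments over the whole line, together with
  \<open>W 0 = 0\<close>, makes the two one-sided motions independent.\<close>
definition two_sided_brownian_motion :: "'a measure \<Rightarrow> (real \<Rightarrow> 'a \<Rightarrow> real) \<Rightarrow> bool" where
  "two_sided_brownian_motion M W \<longleftrightarrow>
     prob_space M \<and>
     (\<forall>t. W t \<in> borel_measurable M) \<and>
     (\<forall>\<omega>\<in>space M. W 0 \<omega> = 0 \<and> continuous_on UNIV (\<lambda>t. W t \<omega>)) \<and>
     (\<forall>s t. s < t \<longrightarrow>
        distributed M lborel (\<lambda>\<omega>. W t \<omega> - W s \<omega>) (normal_density 0 (sqrt (t - s)))) \<and>
     (\<forall>(x :: nat \<Rightarrow> real) k. strict_mono x \<longrightarrow>
        prob_space.indep_vars M (\<lambda>_. borel) (\<lambda>i \<omega>. W (x (Suc i)) \<omega> - W (x i) \<omega>) {..<k})"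

definition noise_level :: "real \<Rightarrow> nat \<Rightarrow> real" where
  "noise_level \<sigma> n = \<sigma> / sqrt (real n)"

text \<open>The data are the path of \<open>Y\<close> on \<open>[-\<eta>, 1 + \<eta>]\<close>, as an extensional function, so that a
  functional of it uses nothing outside the observation window.  The interval integral is signed,
  as needed for \<open>t < 0\<close>.\<close>
definition white_noise_data ::
    "real \<Rightarrow> real \<Rightarrow> (real \<Rightarrow> real) \<Rightarrow> (real \<Rightarrow> 'a \<Rightarrow> real) \<Rightarrow> 'a \<Rightarrow> real \<Rightarrow> real" where
  "white_noise_data \<eta> s f W \<omega> =
     (\<lambda>t\<in>{-\<eta>..1 + \<eta>}. (LBINT u=ereal 0..ereal t. f u) + s * W t \<omega>)"


section \<open>Confidence bands\<close>

definition path_space :: "real \<Rightarrow> (real \<Rightarrow> real) measure" where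
  "path_space \<eta> = restrict_space (PiM {-\<eta>..1 + \<eta>} (\<lambda>_. borel))
     {y. continuous_on {-\<eta>..1 + \<eta>} y}"

text \<open>The empty interval has length \<open>-\<infinity>\<close> here, which is harmless because it covers nothing.\<close>
definition interval_length :: "real set \<Rightarrow> ereal" where
  "interval_length A = Sup (ereal ` A) - Inf (ereal ` A)"

text \<open>\<open>C x y\<close> is the interval at \<open>x\<close> computed from the data \<open>y\<close>.\<close>
definition confidence_band :: "real \<Rightarrow> (real \<Rightarrow> (real \<Rightarrow> real) \<Rightarrow> real set) \<Rightarrow> bool" where
  "confidence_band \<eta> C \<longleftrightarrow> (\<forall>x\<in>{0..1}.
     (\<forall>y\<in>space (path_space \<eta>). is_interval (C x y)) \<and>
     (\<lambda>y. Inf (ereal ` C x y)) \<in> borel_measurable (path_space \<eta>) \<and>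
     (\<lambda>y. Sup (ereal ` C x y)) \<in> borel_measurable (path_space \<eta>))"

text \<open>The outcomes at which the band \<open>C\<close>, computed from \<open>Y \<omega>\<close>, has length at most \<open>r\<close> everywhere
  and covers \<open>f\<close>.\<close>
definition narrow_cover_event ::
    "'a measure \<Rightarrow> (real \<Rightarrow> (real \<Rightarrow> real) \<Rightarrow> real set) \<Rightarrow> ('a \<Rightarrow> real \<Rightarrow> real) \<Rightarrow> real \<Rightarrow>
       (real \<Rightarrow> real) \<Rightarrow> 'a set" where
  "narrow_cover_event M C Y r f = {\<omega> \<in> space M.
     (SUP x\<in>{0..1}. interval_length (C x (Y \<omega>))) \<le> ereal r \<and>
     (\<forall>x\<in>{0..1}. f x \<in> C x (Y \<omega>))}"

definition band_rate :: "real \<Rightarrow> real \<Rightarrow> real \<Rightarrow> real \<Rightarrow> real" where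
  "band_rate s \<gamma> B \<epsilon> =
     (B / \<epsilon>) powr (1 / (2 * \<gamma> + 1)) * (s\<^sup>2 * ln (1 / s\<^sup>2)) powr (\<gamma> / (2 * \<gamma> + 1))"

text \<open>The infimum over the class of the probability of the event above.  Inserting \<open>1\<close> changes
  nothing for a nonempty class and gives the empty class the infimum of the empty subset of
  \<open>[0, 1]\<close>.  A non-measurable event counts as probability \<open>0\<close>, so convergence of this infimum
  to \<open>1\<close> also forces the events to be measurable for all large \<open>n\<close>.\<close>
definition worst_case_prob ::
    "'a measure \<Rightarrow> (real \<Rightarrow> 'a \<Rightarrow> real) \<Rightarrow> (real \<Rightarrow> real \<Rightarrow> real) \<Rightarrow> real \<Rightarrow> real \<Rightarrow> real \<Rightarrow> real set \<Rightarrow>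
       real set \<Rightarrow> real \<Rightarrow> real \<Rightarrow> (real \<Rightarrow> (real \<Rightarrow> real) \<Rightarrow> real set) \<Rightarrow> real" where
  "worst_case_prob M W K j0 \<eta> s \<Gamma> \<B> \<epsilon> c C =
     Inf (insert 1 {measure M (narrow_cover_event M C (white_noise_data \<eta> s f W)
                                 (c * band_rate s \<gamma> B \<epsilon>) f) | \<gamma> B f.
                    \<gamma> \<in> \<Gamma> \<and> B \<in> \<B> \<and> f \<in> self_similar_class K j0 \<gamma> B \<epsilon>})"

end

theory Submission
  imports Defs "HOL-Real_Asymp.Real_Asymp"
begin

text \<open>Instead of smoothing \<open>dY\<close> with \<open>K\<close>, the band uses the derivative of the piecewise
  interpolating polynomial of \<open>Y\<close> on the grid \<open>2\<^sup>-\<^sup>j\<int>\<close>. Its bias on a Hoelder class is of order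
  \<open>B * 2\<^sup>-\<^sup>j\<^sup>\<gamma>\<close>, and its noise, bounded uniformly by a union bound over finitely many
  Gaussian increments, is of order \<open>\<sigma>\<^sub>n * sqrt (2\<^sup>j * log (1/\<sigma>\<^sub>n\<^sup>2))\<close>. Let \<open>E\<^sub>k\<close> be the supremum of
  \<open>\<bar>K\<^sub>k g - g\<bar>\<close>, where \<open>g\<close> is this estimator at a level finer than \<open>k\<close> by a constant \<open>lag\<close>, enlarged
  by its noise. Self-similarity gives \<open>\<epsilon> * B * 2\<^sup>-\<^sup>k\<^sup>\<gamma> \<le> E\<^sub>k\<close>, and since \<open>B\<close> is bounded below
  this is an upper bound on \<open>2\<^sup>-\<^sup>\<gamma>\<close> too. So \<open>E\<^sub>k\<close> bounds \<open>B * 2\<^sup>-\<^sup>j\<^sup>\<gamma>\<close>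
  for all \<open>j \<ge> k\<close> without knowledge of \<open>\<gamma>\<close> or \<open>B\<close>. The band takes the first level \<open>j\<close> at which
  one of these bounds is below the noise. At the level where \<open>B * 2\<^sup>-\<^sup>j\<^sup>\<gamma> / \<epsilon>\<close> matches the noise,
  which gives the claimed rate, extrapolation from a level \<open>k = j - O(1)\<close> succeeds: there \<open>E\<^sub>k\<close> is at
  most a constant times \<open>B * 2\<^sup>-\<^sup>k\<^sup>\<gamma>\<close>, and the error in \<open>\<gamma>\<close> is \<open>O(1/k)\<close>.\<close>

section \<open>Functions of bounded variation\<close>

lemma bounded_variation_abs_diff:
  assumes "bounded_variation g"
  obtains V where "\<And>x y. \<bar>g x - g y\<bar> \<le> V"
proof -
  obtain V where V: "\<And>p n. mono (p :: nat \<Rightarrow> real) \<Longrightarrow> (\<Sum>i<n. \<bar>g (p (Suc i)) - g (p i)\<bar>) \<le> V"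
    using assms unfolding bounded_variation_def by blast
  have le: "\<bar>g y - g x\<bar> \<le> V" if "x \<le> y" for x y
    using V[of "\<lambda>i. if i = 0 then x else y" 1] that by (auto simp: mono_def)
  have "\<bar>g x - g y\<bar> \<le> V" for x y
    using le[of x y] le[of y x] by (cases "x \<le> y") (auto simp: abs_minus_commute)
  then show ?thesis by (rule that)
qed

text \<open>Jordan decomposition: \<open>g\<close> is the difference of the monotone functions
  \<open>T\<close> and \<open>T - g\<close>, where \<open>T x\<close> is the total variation of
  \<open>g\<close> on the half-line up to \<open>x\<close>.\<close>

lemma bounded_variation_borel_measurable:
  assumes "bounded_variation g"
  shows "g \<in> borel_measurable borel"
proof -
  obtain V where V: "\<And>p n. mono (p :: nat \<Rightarrow> real) \<Longrightarrow> (\<Sum>i<n. \<bar>g (p (Suc i)) - g (p i)\<bar>) \<le> V"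
    using assms unfolding bounded_variation_def by blast
  define S where "S x = {(\<Sum>i<n. \<bar>g (p (Suc i)) - g (p i)\<bar>) | p n. mono (p :: nat \<Rightarrow> real) \<and> p n \<le> x}" for x
  define T where "T x = Sup (S x)" for x
  have ne: "S x \<noteq> {}" for x
  proof -
    have "(\<Sum>i<(0::nat). \<bar>g ((\<lambda>_. x) (Suc i)) - g ((\<lambda>_. x) i)\<bar>) \<in> S x"
      unfolding S_def by (intro CollectI exI conjI[OF refl]) (auto simp: mono_def)
    then show ?thesis by blast
  qed
  have bdd: "bdd_above (S x)" for x
    by (rule bdd_aboveI[of _ V]) (auto simp: S_def V)
  have step: "T x + \<bar>g y - g x\<bar> \<le> T y" if xy: "x \<le> y" for x y
  proof -
    have "s \<le> T y - \<bar>g y - g x\<bar>" if s: "s \<in> S x" for s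
    proof -
      obtain p n where p: "mono (p :: nat \<Rightarrow> real)" "p n \<le> x"
        and s_eq: "s = (\<Sum>i<n. \<bar>g (p (Suc i)) - g (p i)\<bar>)"
        using s unfolding S_def by blast
      \<comment> \<open>The jump from \<open>x\<close> to \<open>y\<close> is appended to the
        partition. The values of \<open>p\<close> after index \<open>n\<close> are discarded, since
        they may exceed \<open>x\<close>.\<close>
      define p' where "p' i = (if i \<le> n then p i else if i = Suc n then x else y)" for i
      have pn: "p i \<le> x" if "i \<le> n" for i
        using p monoD[OF p(1) that] by linarith
      have "mono p'"
        using p pn xy by (auto simp: mono_def p'_def intro: order_trans)
      then have "(\<Sum>i<Suc (Suc n). \<bar>g (p' (Suc i)) - g (p' i)\<bar>) \<in> S y"
        unfolding S_def using xy
        by (intro CollectI exI[of _ p'] exI[of _ "Suc (Suc n)"] conjI[OF refl]) (auto simp: p'_def)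
      then have "(\<Sum>i<Suc (Suc n). \<bar>g (p' (Suc i)) - g (p' i)\<bar>) \<le> T y"
        unfolding T_def by (rule cSup_upper[OF _ bdd])
      moreover have "(\<Sum>i<n. \<bar>g (p' (Suc i)) - g (p' i)\<bar>) = s"
        unfolding s_eq by (rule sum.cong) (auto simp: p'_def)
      ultimately show ?thesis
        by (simp add: p'_def)
    qed
    then have "T x \<le> T y - \<bar>g y - g x\<bar>"
      unfolding T_def[of x] by (intro cSup_least ne)
    then show ?thesis by simp
  qed
  have "mono T" using step by (intro monoI) (meson abs_ge_zero add_increasing2 order_trans order_refl le_add_same_cancel1)
  moreover have "mono (\<lambda>x. T x - g x)"
  proof (rule monoI)
    fix x y :: real assume "x \<le> y"
    from step[OF this] show "T x - g x \<le> T y - g y" by linarith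
  qed
  ultimately have "(\<lambda>x. T x - (T x - g x)) \<in> borel_measurable borel"
    by (intro borel_measurable_diff borel_measurable_mono)
  then show ?thesis by simp
qed


section \<open>Numerical differentiation of the primitive\<close>

definition lagrange_basis :: "nat \<Rightarrow> nat \<Rightarrow> real poly" where
  "lagrange_basis D k = (\<Prod>j\<in>{..D} - {k}. smult (1 / (real k - real j)) [:- real j, 1:])"

lemma poly_lagrange_basis:
  assumes "i \<le> D" "k \<le> D"
  shows "poly (lagrange_basis D k) (real i) = (if i = k then 1 else 0)"
proof (cases "i = k")
  case True
  have "(\<Prod>j\<in>{..D} - {k}. poly (smult (1 / (real k - real j)) [:- real j, 1:]) (real k)) = 1"
    by (intro prod.neutral ballI) (simp add: diff_divide_distrib[symmetric])
  then show ?thesis using True by (simp add: lagrange_basis_def poly_prod)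
next
  case False
  then show ?thesis using assms
    by (auto simp: lagrange_basis_def poly_prod intro!: prod_zero bexI[of _ i])
qed

lemma degree_lagrange_basis:
  assumes "k \<le> D"
  shows "degree (lagrange_basis D k) \<le> D"
proof -
  have "degree (lagrange_basis D k)
      \<le> (\<Sum>j\<in>{..D} - {k}. degree (smult (1 / (real k - real j)) [:- real j, 1:]))"
    unfolding lagrange_basis_def by (rule degree_prod_sum_le[unfolded o_def]) auto
  also have "\<dots> \<le> (\<Sum>j\<in>{..D} - {k}. 1)"
    by (intro sum_mono) auto
  finally show ?thesis using assms by simp
qed

lemma lagrange_interpolation:
  assumes "degree p \<le> D"
  shows "p = (\<Sum>k\<le>D. smult (poly p (real k)) (lagrange_basis D k))"
proof (rule poly_eqI_degree[of "real ` {..D}"])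
  fix x assume "x \<in> real ` {..D}"
  then obtain i where i: "i \<le> D" "x = real i" by auto
  have "(\<Sum>k\<le>D. poly p (real k) * poly (lagrange_basis D k) (real i))
      = (\<Sum>k\<le>D. if i = k then poly p (real k) else 0)"
    using i by (intro sum.cong refl) (simp add: poly_lagrange_basis)
  then show "poly p x = poly (\<Sum>k\<le>D. smult (poly p (real k)) (lagrange_basis D k)) x"
    using i by (simp add: poly_sum)
next
  have card: "card (real ` {..D}) = Suc D" by (simp add: card_image)
  show "card (real ` {..D}) > degree p" using assms card by simp
  have "degree (\<Sum>k\<le>D. smult (poly p (real k)) (lagrange_basis D k)) \<le> D"
    by (intro degree_sum_le) (auto intro: order_trans[OF degree_smult_le] degree_lagrange_basis)
  then show "card (real ` {..D}) > degree (\<Sum>k\<le>D. smult (poly p (real k)) (lagrange_basis D k))"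
    using card by simp
qed

text \<open>The weight of the sample at the integer \<open>i\<close> in the derivative at
  \<open>u\<close> of the polynomial interpolating at the \<open>D + 1\<close> integers that start
  from the floor of \<open>u\<close>.\<close>

definition diff_weight :: "nat \<Rightarrow> int \<Rightarrow> real \<Rightarrow> real" where
  "diff_weight D i u = (if \<lfloor>u\<rfloor> \<le> i \<and> i \<le> \<lfloor>u\<rfloor> + int D
     then poly (pderiv (lagrange_basis D (nat (i - \<lfloor>u\<rfloor>)))) (frac u) else 0)"

text \<open>The floor of \<open>u\<close> takes countably many values, and for each of them the
  weight is zero or a polynomial in \<open>u\<close>.\<close>

lemma diff_weight_borel_measurable [measurable]: "diff_weight D i \<in> borel_measurable borel"
proof -
  have "(\<lambda>u. (\<lambda>z u. if z \<le> i \<and> i \<le> z + int D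
     then poly (pderiv (lagrange_basis D (nat (i - z)))) (u - of_int z) else 0) \<lfloor>u\<rfloor> u)
     \<in> borel_measurable borel"
  proof (rule measurable_compose_countable)
    fix z :: int
    have "continuous_on UNIV (\<lambda>u. poly (pderiv (lagrange_basis D (nat (i - z)))) (u - of_int z))"
      by (intro continuous_intros)
    then have "(\<lambda>u. poly (pderiv (lagrange_basis D (nat (i - z)))) (u - of_int z))
        \<in> borel_measurable borel"
      by (rule borel_measurable_continuous_onI)
    then show "(\<lambda>u. if z \<le> i \<and> i \<le> z + int D
       then poly (pderiv (lagrange_basis D (nat (i - z)))) (u - of_int z) else 0)
       \<in> borel_measurable borel"
      by simp
  qed measurable
  then show ?thesis
    unfolding diff_weight_def[abs_def] frac_def .
qed

text \<open>Nonzero weights depend only on the offset \<open>i - \<lfloor>u\<rfloor>\<close> in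
  \<open>0..D\<close> and on \<open>frac u\<close>, so only \<open>D + 1\<close> continuous
  functions on a compact interval have to be bounded.\<close>

lemma diff_weight_bounded:
  obtains A where "A > 0" "\<And>i u. \<bar>diff_weight D i u\<bar> \<le> A"
proof -
  have "\<exists>a. \<forall>v\<in>{0..1}. \<bar>poly (pderiv (lagrange_basis D k)) v\<bar> \<le> a" for k
  proof -
    have "continuous_on {0..1} (poly (pderiv (lagrange_basis D k)))"
      by (intro continuous_intros)
    then have "bounded (poly (pderiv (lagrange_basis D k)) ` {0..1})"
      by (intro compact_imp_bounded compact_continuous_image) auto
    then show ?thesis by (auto simp: bounded_iff)
  qed
  then obtain a where a: "\<And>k v. v \<in> {0..1} \<Longrightarrow> \<bar>poly (pderiv (lagrange_basis D k)) v\<bar> \<le> a k"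
    by metis
  define A where "A = 1 + (\<Sum>k\<le>D. \<bar>a k\<bar>)"
  have A0: "A > 0" unfolding A_def by (intro add_pos_nonneg sum_nonneg) auto
  have "\<bar>diff_weight D i u\<bar> \<le> A" for i u
  proof (cases "\<lfloor>u\<rfloor> \<le> i \<and> i \<le> \<lfloor>u\<rfloor> + int D")
    case True
    define k where "k = nat (i - \<lfloor>u\<rfloor>)"
    have "frac u \<in> {0..1}" using frac_ge_0[of u] frac_lt_1[of u] by (simp add: less_imp_le)
    then have "\<bar>diff_weight D i u\<bar> \<le> a k"
      using True a[of "frac u" k] by (simp add: diff_weight_def k_def)
    also have "\<dots> \<le> \<bar>a k\<bar>" by simp
    also have "\<dots> \<le> (\<Sum>k\<le>D. \<bar>a k\<bar>)"
      using True by (intro member_le_sum) (auto simp: k_def)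
    finally show ?thesis by (simp add: A_def)
  qed (use A0 in \<open>auto simp: diff_weight_def\<close>)
  with A0 show ?thesis by (rule that)
qed

lemma sum_diff_weight:
  assumes "finite I" "{\<lfloor>u\<rfloor>..\<lfloor>u\<rfloor> + int D} \<subseteq> I"
  shows "(\<Sum>i\<in>I. diff_weight D i u * g i)
       = (\<Sum>k\<le>D. poly (pderiv (lagrange_basis D k)) (frac u) * g (\<lfloor>u\<rfloor> + int k))"
proof -
  have inj: "inj_on (\<lambda>k. \<lfloor>u\<rfloor> + int k) {..D}" by (auto simp: inj_on_def)
  have im: "(\<lambda>k. \<lfloor>u\<rfloor> + int k) ` {..D} = {\<lfloor>u\<rfloor>..\<lfloor>u\<rfloor> + int D}"
  proof (intro equalityI subsetI)
    fix i assume "i \<in> {\<lfloor>u\<rfloor>..\<lfloor>u\<rfloor> + int D}"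
    then show "i \<in> (\<lambda>k. \<lfloor>u\<rfloor> + int k) ` {..D}"
      by (intro image_eqI[of _ _ "nat (i - \<lfloor>u\<rfloor>)"]) auto
  qed auto
  have "(\<Sum>i\<in>I. diff_weight D i u * g i) = (\<Sum>i\<in>{\<lfloor>u\<rfloor>..\<lfloor>u\<rfloor> + int D}. diff_weight D i u * g i)"
    using assms by (intro sum.mono_neutral_right) (auto simp: diff_weight_def)
  also have "\<dots> = (\<Sum>k\<le>D. diff_weight D (\<lfloor>u\<rfloor> + int k) u * g (\<lfloor>u\<rfloor> + int k))"
    unfolding im[symmetric] by (subst sum.reindex[OF inj]) simp
  also have "\<dots> = (\<Sum>k\<le>D. poly (pderiv (lagrange_basis D k)) (frac u) * g (\<lfloor>u\<rfloor> + int k))"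
    by (intro sum.cong refl) (simp add: diff_weight_def)
  finally show ?thesis .
qed

text \<open>Interpolation is exact for the \<open>r\<close>-th power of the distance from
  \<open>u\<close> when \<open>r \<le> D\<close>, so the sum is the derivative of that power at
  \<open>u\<close> itself, which is nonzero only for \<open>r = 1\<close>.\<close>

lemma sum_diff_weight_power:
  assumes "finite I" "{\<lfloor>u\<rfloor>..\<lfloor>u\<rfloor> + int D} \<subseteq> I" "r \<le> D"
  shows "(\<Sum>i\<in>I. diff_weight D i u * (of_int i - u) ^ r) = (if r = 1 then 1 else 0)"
proof -
  define v where "v = frac u"
  define p where "p = [:- v, 1:] ^ r"
  have p: "poly p x = (x - v) ^ r" for x
    by (simp add: p_def poly_power)
  have "degree p \<le> D"
    using assms(3) by (simp add: p_def degree_linear_power)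
  then have "pderiv p = (\<Sum>k\<le>D. smult (poly p (real k)) (pderiv (lagrange_basis D k)))"
    by (subst lagrange_interpolation[of p D]) (simp_all add: higher_pderiv_sum[of 1, simplified] pderiv_smult)
  then have "poly (pderiv p) v
      = (\<Sum>k\<le>D. poly (pderiv (lagrange_basis D k)) v * poly p (real k))"
    by (simp add: poly_sum mult.commute)
  also have "\<dots> = (\<Sum>i\<in>I. diff_weight D i u * (of_int i - u) ^ r)"
    unfolding sum_diff_weight[OF assms(1,2)] p
    by (intro sum.cong refl) (simp add: v_def frac_def algebra_simps)
  also have "poly (pderiv p) v = (if r = 1 then 1 else 0)"
    by (cases r) (auto simp: p_def pderiv_power_Suc pderiv_pCons poly_power simp del: power_Suc)
  finally show ?thesis by simp
qed

text \<open>At most \<open>D + 1\<close> weights are nonzero, however large \<open>I\<close>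
  is.\<close>

lemma sum_diff_weight_abs_le:
  assumes "finite I" and A: "\<And>i. \<bar>diff_weight D i u\<bar> \<le> A"
    and g: "\<And>i. \<lfloor>u\<rfloor> \<le> i \<Longrightarrow> i \<le> \<lfloor>u\<rfloor> + int D \<Longrightarrow> \<bar>g i\<bar> \<le> G" and "G \<ge> 0"
  shows "\<bar>\<Sum>i\<in>I. diff_weight D i u * g i\<bar> \<le> (real D + 1) * A * G"
proof -
  have A0: "A \<ge> 0" using A[of 0] by linarith
  define J where "J = {\<lfloor>u\<rfloor>..\<lfloor>u\<rfloor> + int D}"
  have "\<bar>\<Sum>i\<in>I. diff_weight D i u * g i\<bar> \<le> (\<Sum>i\<in>I. \<bar>diff_weight D i u * g i\<bar>)"
    by (rule sum_abs)
  also have "\<dots> = (\<Sum>i\<in>I \<inter> J. \<bar>diff_weight D i u * g i\<bar>)"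
    using assms(1) by (intro sum.mono_neutral_right) (auto simp: J_def diff_weight_def)
  also have "\<dots> \<le> (\<Sum>i\<in>I \<inter> J. A * G)"
    using A0 by (intro sum_mono) (auto simp: abs_mult J_def intro!: mult_mono A g)
  also have "\<dots> = real (card (I \<inter> J)) * (A * G)" by simp
  also have "\<dots> \<le> real (card J) * (A * G)"
    using A0 \<open>G \<ge> 0\<close> by (intro mult_right_mono of_nat_mono card_mono) (auto simp: J_def)
  also have "card J = D + 1" by (simp add: J_def)
  finally show ?thesis by (simp add: mult.assoc add.commute)
qed


section \<open>Hoelder classes and the differentiation error for their primitives\<close>

lemma strict_floor_less:
  assumes "\<gamma> > 0"
  shows "real (strict_floor \<gamma>) < \<gamma>"
proof -
  have "0 < \<lceil>\<gamma>\<rceil>" using assms by simp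
  then have "real (strict_floor \<gamma>) = of_int \<lceil>\<gamma>\<rceil> - 1" by (simp add: strict_floor_def)
  then show "real (strict_floor \<gamma>) < \<gamma>" by linarith
qed

lemma strict_floor_mono: "\<gamma> \<le> \<gamma>' \<Longrightarrow> strict_floor \<gamma> \<le> strict_floor \<gamma>'"
  unfolding strict_floor_def by (intro nat_mono diff_mono ceiling_mono) auto

lemma holder_class_continuous_on:
  assumes f: "f \<in> holder_class \<gamma> B" and "\<gamma> > 0"
  shows "continuous_on UNIV f"
proof (cases "strict_floor \<gamma>")
  case 0
  have "isCont f t" for t
    unfolding isCont_def
  proof (rule Lim_null[THEN iffD2], rule Lim_null_comparison)
    show "\<forall>\<^sub>F y in at t. norm (f y - f t) \<le> B * \<bar>y - t\<bar> powr \<gamma>"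
      using f 0 by (auto simp: holder_class_def)
    have "((\<lambda>y. B * \<bar>y - t\<bar> powr \<gamma>) \<longlongrightarrow> B * \<bar>t - t\<bar> powr \<gamma>) (at t)"
      using \<open>\<gamma> > 0\<close> by (intro tendsto_intros tendsto_powr2) (auto intro!: always_eventually tendsto_eq_intros)
    then show "((\<lambda>y. B * \<bar>y - t\<bar> powr \<gamma>) \<longlongrightarrow> 0) (at t)"
      using \<open>\<gamma> > 0\<close> by simp
  qed
  then show ?thesis by (simp add: continuous_at_imp_continuous_on)
next
  case (Suc m)
  have "\<forall>i<strict_floor \<gamma>. \<forall>t. (deriv ^^ i) f differentiable (at t)"
    using f by (simp add: holder_class_def)
  then have "f differentiable (at t)" for t
    using Suc by (metis funpow_0 zero_less_Suc)
  then show ?thesis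
    by (simp add: differentiable_imp_continuous_within continuous_at_imp_continuous_on)
qed

text \<open>Taylor expansion of \<open>F\<close> to order \<open>m + 1\<close> with Lagrange
  remainder: the top coefficient is the \<open>m\<close>-th derivative of \<open>f\<close> at an
  intermediate point, and moving that point to \<open>x\<close> costs the Hoelder modulus.\<close>

lemma holder_class_primitive_taylor:
  assumes f: "f \<in> holder_class \<gamma> B" and "\<gamma> > 0" "B \<ge> 0"
    and F: "\<And>t. (F has_real_derivative f t) (at t)"
  defines "m \<equiv> strict_floor \<gamma>"
  shows "\<bar>F y - F x - (\<Sum>r\<le>m. (deriv ^^ r) f x / fact (Suc r) * (y - x) ^ Suc r)\<bar>
     \<le> B * \<bar>y - x\<bar> powr (\<gamma> + 1)"
proof (cases "y = x")
  case False
  \<comment> \<open>Index 0 is \<open>F\<close>, so the Hoelder condition concerns index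
    \<open>Suc m\<close>.\<close>
  define diff where "diff r = (case r of 0 \<Rightarrow> F | Suc r \<Rightarrow> (deriv ^^ r) f)" for r
  have D: "(diff r has_real_derivative diff (Suc r) t) (at t)" if "r < Suc m" for r t
  proof (cases r)
    case (Suc k)
    then have "((deriv ^^ k) f) differentiable (at t)"
      using f that by (simp add: holder_class_def m_def)
    then show ?thesis
      by (simp add: Suc diff_def DERIV_deriv_iff_real_differentiable)
  qed (simp add: diff_def F)
  have "\<exists>t. \<bar>t\<bar> \<le> \<bar>y - x\<bar> \<and> F (x + (y - x)) =
      (\<Sum>r<Suc m. diff r (x + 0) / fact r * (y - x) ^ r)
      + diff (Suc m) (x + t) / fact (Suc m) * (y - x) ^ Suc m"
  proof (rule Maclaurin_bi_le[where diff = "\<lambda>r t. diff r (x + t)"])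
    show "\<forall>r t. r < Suc m \<and> \<bar>t\<bar> \<le> \<bar>y - x\<bar> \<longrightarrow>
        ((\<lambda>t. diff r (x + t)) has_real_derivative diff (Suc r) (x + t)) (at t)"
    proof (intro allI impI)
      fix r t assume "r < Suc m \<and> \<bar>t\<bar> \<le> \<bar>y - x\<bar>"
      then show "((\<lambda>t. diff r (x + t)) has_real_derivative diff (Suc r) (x + t)) (at t)"
        using DERIV_shift[THEN iffD1, OF D[of r "t + x"]] by (simp only: add.commute[of x])
    qed
  qed (simp add: diff_def)
  then obtain t where t: "\<bar>t\<bar> \<le> \<bar>y - x\<bar>" and F_y: "F y =
      (\<Sum>r<Suc m. diff r x / fact r * (y - x) ^ r)
      + diff (Suc m) (x + t) / fact (Suc m) * (y - x) ^ Suc m"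
    by auto
  define T where "T r = (deriv ^^ r) f x / fact (Suc r) * (y - x) ^ Suc r" for r
  define G where "G = (deriv ^^ m) f (x + t) / fact (Suc m) * (y - x) ^ Suc m"
  have "(\<Sum>r<Suc m. diff r x / fact r * (y - x) ^ r) = F x + (\<Sum>r<m. T r)"
    unfolding sum.lessThan_Suc_shift by (simp add: diff_def T_def)
  moreover have "diff (Suc m) (x + t) / fact (Suc m) * (y - x) ^ Suc m = G"
    by (simp add: diff_def G_def)
  ultimately have "F y = F x + (\<Sum>r<m. T r) + G"
    unfolding F_y by simp
  then have "F y - F x - (\<Sum>r\<le>m. T r) = G - T m"
    by (simp add: lessThan_Suc_atMost[symmetric])
  also have "\<dots> = ((deriv ^^ m) f (x + t) - (deriv ^^ m) f x) / fact (Suc m) * (y - x) ^ Suc m"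
    unfolding G_def T_def by (simp only: left_diff_distrib diff_divide_distrib)
  finally have "F y - F x - (\<Sum>r\<le>m. (deriv ^^ r) f x / fact (Suc r) * (y - x) ^ Suc r)
      = ((deriv ^^ m) f (x + t) - (deriv ^^ m) f x) / fact (Suc m) * (y - x) ^ Suc m"
    unfolding T_def .
  then have "\<bar>F y - F x - (\<Sum>r\<le>m. (deriv ^^ r) f x / fact (Suc r) * (y - x) ^ Suc r)\<bar>
      = \<bar>(deriv ^^ m) f (x + t) - (deriv ^^ m) f x\<bar> / fact (Suc m) * \<bar>y - x\<bar> ^ Suc m"
    by (simp add: abs_mult power_abs)
  also have "\<dots> \<le> \<bar>(deriv ^^ m) f (x + t) - (deriv ^^ m) f x\<bar> / 1 * \<bar>y - x\<bar> ^ Suc m"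
    by (intro mult_right_mono divide_left_mono fact_ge_1) auto
  also have "\<dots> \<le> (B * \<bar>y - x\<bar> powr (\<gamma> - real m)) * \<bar>y - x\<bar> ^ Suc m"
  proof (intro mult_right_mono)
    have "\<bar>(deriv ^^ m) f (x + t) - (deriv ^^ m) f x\<bar> \<le> B * \<bar>t\<bar> powr (\<gamma> - real m)"
      using f by (auto simp: holder_class_def m_def dest!: spec2[of _ "x + t" x])
    also have "\<dots> \<le> B * \<bar>y - x\<bar> powr (\<gamma> - real m)"
      using t \<open>B \<ge> 0\<close> strict_floor_less[OF \<open>\<gamma> > 0\<close>]
      by (intro mult_left_mono powr_mono2) (auto simp: m_def)
    finally show "\<bar>(deriv ^^ m) f (x + t) - (deriv ^^ m) f x\<bar> / 1 \<le> B * \<bar>y - x\<bar> powr (\<gamma> - real m)"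
      by simp
  qed auto
  also have "\<dots> = B * \<bar>y - x\<bar> powr (\<gamma> + 1)"
  proof -
    have "\<bar>y - x\<bar> ^ Suc m = \<bar>y - x\<bar> powr real (Suc m)"
      using False by (intro powr_realpow[symmetric]) auto
    then show ?thesis by (simp add: powr_add[symmetric] mult.assoc add.commute)
  qed
  finally show ?thesis .
qed simp

text \<open>After a Taylor expansion of \<open>F\<close> at \<open>x\<close>, the moment identities
  remove the constant and all powers from 2 to \<open>m + 1 \<le> D\<close>. The linear term gives
  \<open>f x\<close>, and only the remainder is left as error.\<close>

lemma sum_diff_weight_primitive:
  assumes f: "f \<in> holder_class \<gamma> B" and "\<gamma> > 0" "B \<ge> 0" "h > 0"
    and F: "\<And>t. (F has_real_derivative f t) (at t)"
    and D: "strict_floor \<gamma> < D" "\<gamma> \<le> \<gamma>'"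
    and A: "\<And>i u. \<bar>diff_weight D i u\<bar> \<le> A"
    and I: "finite I" "{\<lfloor>x / h\<rfloor>..\<lfloor>x / h\<rfloor> + int D} \<subseteq> I"
  shows "\<bar>(\<Sum>i\<in>I. diff_weight D i (x / h) * F (of_int i * h)) / h - f x\<bar>
     \<le> (real D + 1) * A * real D powr (\<gamma>' + 1) * B * h powr \<gamma>"
proof -
  define u where "u = x / h"
  define m where "m = strict_floor \<gamma>"
  have x: "x = u * h" using \<open>h > 0\<close> by (simp add: u_def)
  define c where "c r = (deriv ^^ r) f x / fact (Suc r)" for r
  define R where "R y = F y - F x - (\<Sum>r\<le>m. c r * (y - x) ^ Suc r)" for y
  have R: "\<bar>R y\<bar> \<le> B * \<bar>y - x\<bar> powr (\<gamma> + 1)" for y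
    using holder_class_primitive_taylor[OF f \<open>\<gamma> > 0\<close> \<open>B \<ge> 0\<close> F, of y x]
    by (simp add: R_def c_def m_def)
  note I = I[folded u_def]
  have moment: "(\<Sum>i\<in>I. diff_weight D i u * (of_int i - u) ^ r) = (if r = 1 then 1 else 0)"
    if "r \<le> D" for r
    using sum_diff_weight_power[OF I that] .
  have "F (of_int i * h) = F x + (\<Sum>r\<le>m. c r * h ^ Suc r * (of_int i - u) ^ Suc r) + R (of_int i * h)" for i
  proof -
    have *: "of_int i * h - x = (of_int i - u) * h" by (simp add: x algebra_simps)
    show ?thesis unfolding R_def * power_mult_distrib by (simp add: mult_ac)
  qed
  then have "(\<Sum>i\<in>I. diff_weight D i u * F (of_int i * h))
     = (\<Sum>i\<in>I. diff_weight D i u * (F x + (\<Sum>r\<le>m. c r * h ^ Suc r * (of_int i - u) ^ Suc r)))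
       + (\<Sum>i\<in>I. diff_weight D i u * R (of_int i * h))"
    by (simp add: algebra_simps sum.distrib)
  also have "(\<Sum>i\<in>I. diff_weight D i u * (F x + (\<Sum>r\<le>m. c r * h ^ Suc r * (of_int i - u) ^ Suc r)))
     = F x * (\<Sum>i\<in>I. diff_weight D i u * (of_int i - u) ^ 0)
       + (\<Sum>r\<le>m. c r * h ^ Suc r * (\<Sum>i\<in>I. diff_weight D i u * (of_int i - u) ^ Suc r))"
    unfolding distrib_left sum.distrib sum_distrib_left
    by (subst sum.swap[of _ I]) (simp add: mult_ac)
  also have "\<dots> = (\<Sum>r\<le>m. c r * h ^ Suc r * (if Suc r = 1 then 1 else 0))"
  proof -
    have "(\<Sum>i\<in>I. diff_weight D i u * (of_int i - u) ^ 0) = 0"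
      using moment[of 0] by simp
    moreover have "(\<Sum>i\<in>I. diff_weight D i u * (of_int i - u) ^ Suc r) = (if Suc r = 1 then 1 else 0)"
      if "r \<le> m" for r
      using that D(1) by (intro moment) (simp add: m_def)
    ultimately show ?thesis by simp
  qed
  also have "\<dots> = (\<Sum>r\<le>m. if r = 0 then c 0 * h else 0)"
    by (intro sum.cong) auto
  also have "\<dots> = f x * h"
    by (simp add: c_def)
  finally have "(\<Sum>i\<in>I. diff_weight D i u * F (of_int i * h)) / h - f x
      = (\<Sum>i\<in>I. diff_weight D i u * R (of_int i * h)) / h"
    using \<open>h > 0\<close> by (simp add: field_simps)
  moreover have "\<bar>\<Sum>i\<in>I. diff_weight D i u * R (of_int i * h)\<bar>
      \<le> (real D + 1) * A * (B * (real D * h) powr (\<gamma> + 1))"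
  proof (rule sum_diff_weight_abs_le[OF I(1) A])
    fix i assume i: "\<lfloor>u\<rfloor> \<le> i" "i \<le> \<lfloor>u\<rfloor> + int D"
    \<comment> \<open>The floor puts the first node less than one spacing to the left of
      \<open>u\<close>; as \<open>D \<ge> 1\<close>, every node is within \<open>D\<close>
      spacings.\<close>
    have "of_int i - u \<le> real D" "- 1 \<le> of_int i - u"
      using i by linarith+
    then have "\<bar>of_int i - u\<bar> \<le> real D" using D(1) by linarith
    then have "\<bar>of_int i * h - x\<bar> \<le> real D * h"
      using \<open>h > 0\<close> by (simp add: x left_diff_distrib[symmetric] abs_mult)
    then show "\<bar>R (of_int i * h)\<bar> \<le> B * (real D * h) powr (\<gamma> + 1)"
      using \<open>B \<ge> 0\<close> \<open>\<gamma> > 0\<close> by (intro order_trans[OF R] mult_left_mono powr_mono2) auto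
  qed (use \<open>B \<ge> 0\<close> in auto)
  ultimately have "\<bar>(\<Sum>i\<in>I. diff_weight D i u * F (of_int i * h)) / h - f x\<bar>
      \<le> (real D + 1) * A * (B * (real D * h) powr (\<gamma> + 1)) / h"
    using \<open>h > 0\<close> by (simp add: divide_right_mono)
  also have "\<dots> = (real D + 1) * A * real D powr (\<gamma> + 1) * B * h powr \<gamma>"
    using \<open>h > 0\<close> by (simp add: powr_mult powr_add)
  \<comment> \<open>Raising the exponent, possible as \<open>D \<ge> 1\<close>, frees the constant
    from the unknown \<gamma>.\<close>
  also have "\<dots> \<le> (real D + 1) * A * real D powr (\<gamma>' + 1) * B * h powr \<gamma>"
  proof -
    have "A \<ge> 0" using A[of 0 0] by linarith
    then show ?thesis
      using \<open>B \<ge> 0\<close> D \<open>h > 0\<close> by (intro mult_right_mono mult_left_mono powr_mono) auto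
  qed
  finally show ?thesis by (simp add: u_def)
qed

text \<open>The weights sum to zero, so \<open>g\<close> can be recentred at the first node and
  telescoped. Thus the size of the Brownian path itself never enters, only that of its grid
  increments.\<close>

lemma sum_diff_weight_increments:
  assumes "\<And>i u. \<bar>diff_weight D i u\<bar> \<le> A" "a \<ge> 0"
    and I: "finite I" "{\<lfloor>u\<rfloor>..\<lfloor>u\<rfloor> + int D} \<subseteq> I"
    and g: "\<And>i. i \<in> I \<Longrightarrow> \<bar>g (i + 1) - g i\<bar> \<le> (a::real)"
  shows "\<bar>\<Sum>i\<in>I. diff_weight D i u * g i\<bar> \<le> (real D + 1) * A * (real D * a)"
proof -
  have incr: "\<bar>g (\<lfloor>u\<rfloor> + int k) - g \<lfloor>u\<rfloor>\<bar> \<le> real k * a" if "k \<le> D" for k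
    using that
  proof (induction k)
    case (Suc k)
    then have "\<bar>g (\<lfloor>u\<rfloor> + int k + 1) - g (\<lfloor>u\<rfloor> + int k)\<bar> \<le> a"
      using I(2) by (intro g) auto
    with Suc show ?case by (simp add: algebra_simps)
  qed simp
  have "(\<Sum>i\<in>I. diff_weight D i u) = 0"
    using sum_diff_weight_power[OF I, of 0] by simp
  then have "(\<Sum>i\<in>I. diff_weight D i u * g i) = (\<Sum>i\<in>I. diff_weight D i u * (g i - g \<lfloor>u\<rfloor>))"
    by (simp add: right_diff_distrib sum_subtractf sum_distrib_right[symmetric])
  moreover have "\<bar>\<Sum>i\<in>I. diff_weight D i u * (g i - g \<lfloor>u\<rfloor>)\<bar> \<le> (real D + 1) * A * (real D * a)"
  proof (rule sum_diff_weight_abs_le[OF I(1) assms(1)])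
    fix i assume "\<lfloor>u\<rfloor> \<le> i" "i \<le> \<lfloor>u\<rfloor> + int D"
    then have "\<bar>g i - g \<lfloor>u\<rfloor>\<bar> \<le> real (nat (i - \<lfloor>u\<rfloor>)) * a" "nat (i - \<lfloor>u\<rfloor>) \<le> D"
      using incr[of "nat (i - \<lfloor>u\<rfloor>)"] by auto
    then show "\<bar>g i - g \<lfloor>u\<rfloor>\<bar> \<le> real D * a"
      using \<open>a \<ge> 0\<close> by (meson mult_right_mono of_nat_mono order_trans)
  qed (use \<open>a \<ge> 0\<close> in auto)
  ultimately show ?thesis by simp
qed

lemma continuous_primitive_has_real_derivative:
  fixes f :: "real \<Rightarrow> real"
  assumes "continuous_on UNIV f"
  shows "((\<lambda>t. LBINT u=ereal 0..ereal t. f u) has_real_derivative f t) (at t)"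
proof -
  \<comment> \<open>An interval that contains 0 and has \<open>t\<close> in its interior, so that
    the derivative within it is the full derivative.\<close>
  define a b where "a = min 0 t - 1" and "b = max 0 t + 1"
  have "((\<lambda>t. LBINT u=ereal 0..ereal t. f u) has_vector_derivative f t) (at t within {a..b})"
  proof (rule interval_integral_FTC2)
    show "continuous_on {a..b} f" using assms by (rule continuous_on_subset) simp
  qed (auto simp: a_def b_def)
  moreover have "at t within {a..b} = at t"
    by (rule at_within_interior) (auto simp: a_def b_def)
  ultimately show ?thesis
    by (simp only: has_real_derivative_iff_has_vector_derivative)
qed


section \<open>Kernel approximations\<close>

text \<open>The bound on \<open>g\<close> is asked only where \<open>k\<close> is nonzero: functions
  in a Hoelder class may be unbounded on the line, while the kernels have compact support.\<close>

lemma integrable_mult_bounded_on_support: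
  fixes k g :: "'b \<Rightarrow> real"
  assumes k: "integrable M k" and g: "g \<in> borel_measurable M"
    and c: "\<And>x. x \<in> space M \<Longrightarrow> k x \<noteq> 0 \<Longrightarrow> \<bar>g x\<bar> \<le> c"
  shows "integrable M (\<lambda>x. k x * g x)" "\<bar>\<integral>x. k x * g x \<partial>M\<bar> \<le> c * (\<integral>x. \<bar>k x\<bar> \<partial>M)"
proof -
  have *: "\<bar>k x * g x\<bar> \<le> c * \<bar>k x\<bar>" if "x \<in> space M" for x
    using c[OF that] by (cases "k x = 0") (auto simp: abs_mult mult.commute mult_left_mono)
  show int: "integrable M (\<lambda>x. k x * g x)"
  proof (rule Bochner_Integration.integrable_bound)
    show "integrable M (\<lambda>x. c * \<bar>k x\<bar>)" using k by simp
    show "AE x in M. norm (k x * g x) \<le> norm (c * \<bar>k x\<bar>)"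
      using * by (intro AE_I2) (auto intro: order_trans[OF _ abs_ge_self])
  qed (use k g in measurable)
  have "\<bar>\<integral>x. k x * g x \<partial>M\<bar> \<le> (\<integral>x. \<bar>k x * g x\<bar> \<partial>M)"
    by (rule integral_abs_bound)
  also have "\<dots> \<le> (\<integral>x. c * \<bar>k x\<bar> \<partial>M)"
    using int k * by (intro integral_mono) auto
  finally show "\<bar>\<integral>x. k x * g x \<partial>M\<bar> \<le> c * (\<integral>x. \<bar>k x\<bar> \<partial>M)" by simp
qed

lemma integrable_power_abs_compact_support:
  fixes g :: "real \<Rightarrow> real"
  assumes "g \<in> borel_measurable borel" "\<And>x. \<bar>g x\<bar> \<le> b" "\<And>x. x \<notin> {l..u} \<Longrightarrow> g x = 0" "n > 0"
  shows "integrable lborel (\<lambda>x. \<bar>g x\<bar> ^ n)"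
proof (rule Bochner_Integration.integrable_bound)
  have [measurable]: "g \<in> borel_measurable borel" by fact
  show "integrable lborel (\<lambda>x. indicator {l..u} x * b ^ n)"
    by (intro integrable_mult_left) (simp add: emeasure_lborel_Icc_eq)
  show "(\<lambda>x. \<bar>g x\<bar> ^ n) \<in> borel_measurable lborel" by measurable
  have "0 \<le> b" using assms(2)[of 0] by linarith
  then show "AE x in lborel. norm (\<bar>g x\<bar> ^ n) \<le> norm (indicator {l..u} x * b ^ n)"
    using assms by (intro AE_I2) (auto simp: indicator_def power_mono zero_power)
qed

locale compact_kernel =
  fixes K :: "real \<Rightarrow> real \<Rightarrow> real" and CK L :: real
  assumes kernel: "is_kernel K"
    and supp: "\<And>x y. \<bar>x - y\<bar> > CK \<Longrightarrow> K y x = 0"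
    and CK: "CK \<ge> 0"
    and shift: "\<And>(k::int) x y. K y x = K (y - of_int k) (x - of_int k)"
    and L2_bound: "\<And>t. t \<in> {0..1} \<Longrightarrow> (LINT x|lborel. (K t x)\<^sup>2) \<le> L"
begin

lemma kernel_measurable [measurable]: "K t \<in> borel_measurable borel"
  using kernel by (auto simp: is_kernel_def intro: bounded_variation_borel_measurable)

lemma kernel_integrable_power:
  assumes "n > 0"
  shows "integrable lborel (\<lambda>x. \<bar>K t x\<bar> ^ n)"
proof -
  obtain V where V: "\<And>x y. \<bar>K t x - K t y\<bar> \<le> V"
    using bounded_variation_abs_diff[of "K t"] kernel unfolding is_kernel_def by metis
  show ?thesis
  proof (rule integrable_power_abs_compact_support[OF _ _ _ assms])
    show "\<bar>K t x\<bar> \<le> V" for x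
      \<comment> \<open>\<open>K t\<close> vanishes at \<open>t + CK + 1\<close>, so the bound on
        its oscillation bounds its absolute value.\<close>
      using V[of x "t + CK + 1"] supp[where x = "t + CK + 1" and y = t] CK by simp
    show "K t x = 0" if "x \<notin> {t - CK..t + CK}" for x
      using that by (intro supp) auto
  qed measurable
qed

lemma kernel_integrable: "integrable lborel (\<lambda>x. \<bar>K t x\<bar>)"
  using kernel_integrable_power[of 1] by simp

text \<open>The summand 1 only makes the bound positive; \<open>2 * CK + L\<close> comes from
  integrating an indicator plus the squared kernel.\<close>

definition L1_bound :: real where "L1_bound = 2 * CK + 1 + L"

text \<open>Shift invariance reduces \<open>t\<close> to its fractional part, where the square
  integral is at most \<open>L\<close>. On the support, of length at most \<open>2 * CK\<close>, the
  absolute value is at most one plus the square.\<close>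

lemma kernel_L1: "(LINT x|lborel. \<bar>K t x\<bar>) \<le> L1_bound"
proof -
  define v where "v = frac t"
  have v: "v \<in> {0..1}" using frac_ge_0[of t] frac_lt_1[of t] by (simp add: v_def less_imp_le)
  have "(LINT x|lborel. \<bar>K t x\<bar>) = (LINT x|lborel. \<bar>K t (of_int \<lfloor>t\<rfloor> + 1 * x)\<bar>)"
    by (subst lborel_integral_real_affine[where c = 1 and t = "of_int \<lfloor>t\<rfloor>"]) auto
  also have "\<dots> = (LINT x|lborel. \<bar>K v x\<bar>)"
    by (intro Bochner_Integration.integral_cong refl)
       (subst shift[of _ _ "\<lfloor>t\<rfloor>"], simp add: v_def frac_def)
  also have "\<dots> \<le> (LINT x|lborel. indicator {v - CK..v + CK} x + (K v x)\<^sup>2)"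
  proof (intro integral_mono)
    show "integrable lborel (\<lambda>x. indicator {v - CK..v + CK} x + (K v x)\<^sup>2)"
      using kernel_integrable_power[of 2 v] by (intro Bochner_Integration.integrable_add)
        (auto intro!: integrable_real_indicator simp: emeasure_lborel_Icc_eq)
    show "\<bar>K v x\<bar> \<le> indicator {v - CK..v + CK} x + (K v x)\<^sup>2" for x
    proof (cases "x \<in> {v - CK..v + CK}")
      case True
      have "0 \<le> (\<bar>K v x\<bar> - 1)\<^sup>2" "0 \<le> (K v x)\<^sup>2" by auto
      then have "2 * \<bar>K v x\<bar> \<le> 1 + (K v x)\<^sup>2" by (simp add: power2_eq_square algebra_simps)
      then show ?thesis using True \<open>0 \<le> (K v x)\<^sup>2\<close> by auto
    next
      case False
      then have "K v x = 0" by (intro supp) auto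
      then show ?thesis by simp
    qed
  qed (rule kernel_integrable)
  also have "\<dots> = 2 * CK + (LINT x|lborel. (K v x)\<^sup>2)"
    using kernel_integrable_power[of 2 v] CK by (subst Bochner_Integration.integral_add) auto
  finally show ?thesis using L2_bound[OF v] by (simp add: L1_bound_def)
qed

lemma L1_bound_pos: "L1_bound > 0"
proof -
  have "0 \<le> (LINT x|lborel. (K 0 x)\<^sup>2)" by (intro integral_nonneg_AE) auto
  also have "\<dots> \<le> L" by (rule L2_bound) simp
  finally have "0 \<le> L" .
  then show ?thesis using CK by (simp add: L1_bound_def)
qed

lemma kernel_scaled_eq: "kernel_scaled K (int k) t x = 2 ^ k * K (2 ^ k * t) (0 + 2 ^ k * x)"
  by (simp add: kernel_scaled_def)

lemma kernel_scaled_integrable: "integrable lborel (kernel_scaled K (int k) t)"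
proof -
  have "integrable lborel (K (2 ^ k * t))"
    using kernel_integrable integrable_abs_iff[of "K (2 ^ k * t)" lborel] by simp
  then have "integrable lborel (\<lambda>x. K (2 ^ k * t) (0 + 2 ^ k * x))"
    by (rule lborel_integrable_real_affine) simp
  then show ?thesis unfolding kernel_scaled_eq[abs_def] by (rule integrable_mult_right)
qed

lemma kernel_scaled_L1: "(LINT x|lborel. \<bar>kernel_scaled K (int k) t x\<bar>) \<le> L1_bound"
proof -
  have "(LINT x|lborel. \<bar>kernel_scaled K (int k) t x\<bar>) = (LINT x|lborel. \<bar>K (2 ^ k * t) x\<bar>)"
    unfolding kernel_scaled_eq abs_mult
    by (subst (2) lborel_integral_real_affine[where c = "2 ^ k" and t = 0]) auto
  then show ?thesis using kernel_L1 by simp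
qed

lemma kernel_scaled_supp:
  assumes "kernel_scaled K (int k) t x \<noteq> 0"
  shows "\<bar>x - t\<bar> \<le> CK / 2 ^ k"
proof (rule ccontr)
  assume "\<not> ?thesis"
  then have "CK < 2 ^ k * \<bar>x - t\<bar>"
    by (simp add: field_simps)
  also have "\<dots> = \<bar>2 ^ k * x - 2 ^ k * t\<bar>"
    by (simp add: right_diff_distrib[symmetric] abs_mult)
  finally have "CK < \<bar>2 ^ k * x - 2 ^ k * t\<bar>" .
  then have "K (2 ^ k * t) (2 ^ k * x) = 0" by (rule supp)
  with assms show False by (simp add: kernel_scaled_def)
qed

lemma kernel_approx_sum:
  assumes "finite I"
    and "\<And>i. i \<in> I \<Longrightarrow> g i \<in> borel_measurable borel"
    and "\<And>i x. i \<in> I \<Longrightarrow> \<bar>g i x\<bar> \<le> c"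
  shows "kernel_approx K (int k) (\<lambda>x. \<Sum>i\<in>I. y i * g i x) t
       = (\<Sum>i\<in>I. y i * kernel_approx K (int k) (g i) t)"
proof -
  have "integrable lborel (\<lambda>x. kernel_scaled K (int k) t x * g i x)" if "i \<in> I" for i
    using assms that by (intro integrable_mult_bounded_on_support(1)[OF kernel_scaled_integrable, where c = c]) auto
  then have *: "integrable lborel (\<lambda>x. y i * (kernel_scaled K (int k) t x * g i x))" if "i \<in> I" for i
    using that by simp
  have "kernel_approx K (int k) (\<lambda>x. \<Sum>i\<in>I. y i * g i x) t
      = (LINT x|lborel. (\<Sum>i\<in>I. y i * (kernel_scaled K (int k) t x * g i x)))"
    unfolding kernel_approx_def by (simp add: sum_distrib_left mult_ac)
  also have "\<dots> = (\<Sum>i\<in>I. LINT x|lborel. y i * (kernel_scaled K (int k) t x * g i x))"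
    using * by (rule Bochner_Integration.integral_sum)
  finally show ?thesis by (simp add: kernel_approx_def)
qed

lemma kernel_approx_diff_le:
  assumes f: "continuous_on UNIV f" and g: "g \<in> borel_measurable borel"
    and e: "\<And>x. \<bar>x - t\<bar> \<le> CK / 2 ^ k \<Longrightarrow> \<bar>g x - f x\<bar> \<le> e"
  shows "\<bar>kernel_approx K (int k) g t - kernel_approx K (int k) f t\<bar> \<le> e * L1_bound"
proof -
  let ?k = "kernel_scaled K (int k) t"
  have f_meas: "f \<in> borel_measurable borel" using f by (rule borel_measurable_continuous_onI)
  \<comment> \<open>\<open>f\<close> may be unbounded globally; its bound on the compact support of
    the kernel is what allows the integral to be split.\<close>
  have "bounded (f ` cball t (CK / 2 ^ k))"
    using f by (intro compact_imp_bounded compact_continuous_image) (auto intro: continuous_on_subset)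
  then obtain b where b: "\<And>x. \<bar>x - t\<bar> \<le> CK / 2 ^ k \<Longrightarrow> \<bar>f x\<bar> \<le> b"
    by (fastforce simp: bounded_iff dist_real_def abs_minus_commute)
  have "e \<ge> 0" using e[of t] CK by (auto intro: order_trans[OF abs_ge_zero])
  have int_f: "integrable lborel (\<lambda>x. ?k x * f x)"
    using f_meas b by (intro integrable_mult_bounded_on_support(1)[OF kernel_scaled_integrable, where c = b])
      (auto dest!: kernel_scaled_supp)
  have diff: "integrable lborel (\<lambda>x. ?k x * (g x - f x))"
    "\<bar>LINT x|lborel. ?k x * (g x - f x)\<bar> \<le> e * (LINT x|lborel. \<bar>?k x\<bar>)"
    using f_meas g e by (intro integrable_mult_bounded_on_support[OF kernel_scaled_integrable, where c = e];
      auto dest!: kernel_scaled_supp)+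
  have "kernel_approx K (int k) g t = (LINT x|lborel. ?k x * (g x - f x) + ?k x * f x)"
    by (simp add: kernel_approx_def algebra_simps)
  also have "\<dots> = (LINT x|lborel. ?k x * (g x - f x)) + kernel_approx K (int k) f t"
    unfolding kernel_approx_def by (rule Bochner_Integration.integral_add[OF diff(1) int_f])
  finally have "\<bar>kernel_approx K (int k) g t - kernel_approx K (int k) f t\<bar>
      \<le> e * (LINT x|lborel. \<bar>?k x\<bar>)" using diff(2) by simp
  also have "\<dots> \<le> e * L1_bound"
    using \<open>e \<ge> 0\<close> by (intro mult_left_mono kernel_scaled_L1)
  finally show ?thesis .
qed

text \<open>Subtracting \<open>f\<close> and applying the kernel are Lipschitz in the supremum norm
  with constants 1 and \<open>L1_bound\<close>. Closeness is needed only on the interval enlarged by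
  the kernel support, which has to fit into the observation window.\<close>

lemma approx_error_diff_le:
  assumes f: "continuous_on UNIV f" and g: "g \<in> borel_measurable borel"
    and e: "\<And>x. - (CK / 2 ^ k) \<le> x \<Longrightarrow> x \<le> 1 + CK / 2 ^ k \<Longrightarrow> \<bar>g x - f x\<bar> \<le> e"
  shows "approx_error K (int k) g \<le> approx_error K (int k) f + ereal ((1 + L1_bound) * e)"
    and "approx_error K (int k) f \<le> approx_error K (int k) g + ereal ((1 + L1_bound) * e)"
proof -
  have *: "\<bar>(kernel_approx K (int k) g t - g t) - (kernel_approx K (int k) f t - f t)\<bar> \<le> (1 + L1_bound) * e"
    if t: "t \<in> {0..1}" for t
  proof -
    have "\<bar>kernel_approx K (int k) g t - kernel_approx K (int k) f t\<bar> \<le> e * L1_bound"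
      using t by (intro kernel_approx_diff_le[OF f g] e) auto
    moreover have "0 \<le> CK / 2 ^ k" using CK by simp
    then have "\<bar>g t - f t\<bar> \<le> e" using t by (intro e) auto
    ultimately show ?thesis by (simp add: algebra_simps)
  qed
  have sup: "approx_error K (int k) g' \<le> approx_error K (int k) f' + ereal c"
    if *: "\<And>t. t \<in> {0..1} \<Longrightarrow>
      \<bar>(kernel_approx K (int k) g' t - g' t) - (kernel_approx K (int k) f' t - f' t)\<bar> \<le> c" for f' g' c
    unfolding approx_error_def
  proof (rule SUP_least)
    fix t :: real assume t: "t \<in> {0..1}"
    have "ereal \<bar>kernel_approx K (int k) g' t - g' t\<bar>
        \<le> ereal \<bar>kernel_approx K (int k) f' t - f' t\<bar> + ereal c"
      using *[OF t] by simp
    also have "\<dots> \<le> (SUP t\<in>{0..1}. ereal \<bar>kernel_approx K (int k) f' t - f' t\<bar>) + ereal c"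
      using t by (intro add_right_mono SUP_upper)
    finally show "ereal \<bar>kernel_approx K (int k) g' t - g' t\<bar>
        \<le> (SUP t\<in>{0..1}. ereal \<bar>kernel_approx K (int k) f' t - f' t\<bar>) + ereal c" .
  qed
  show "approx_error K (int k) g \<le> approx_error K (int k) f + ereal ((1 + L1_bound) * e)"
    by (rule sup[OF *])
  show "approx_error K (int k) f \<le> approx_error K (int k) g + ereal ((1 + L1_bound) * e)"
    using * by (intro sup) (simp add: abs_minus_commute)
qed

end


section \<open>Suprema of finite-dimensional processes\<close>

text \<open>Although \<open>T\<close> may be uncountable, the supremum is a lower semicontinuous
  function of the coefficients: its strict superlevel sets are unions of open sets. No regularity in
  \<open>t\<close> is required.\<close>

lemma borel_measurable_SUP_linear_combination:
  fixes X :: "'i::countable \<Rightarrow> 'b \<Rightarrow> real"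
  assumes X: "\<And>i. i \<in> I \<Longrightarrow> X i \<in> borel_measurable N"
  shows "(\<lambda>\<omega>. SUP t\<in>T. ereal \<bar>(\<Sum>i\<in>I. X i \<omega> * g i t) - c t\<bar>) \<in> borel_measurable N"
proof -
  define S where "S z = (SUP t\<in>T. ereal \<bar>(\<Sum>i\<in>I. z i * g i t) - c t\<bar>)" for z :: "'i \<Rightarrow> real"
  define \<psi> where "\<psi> \<omega> i = (if i \<in> I then X i \<omega> else 0)" for \<omega> i
  have "S \<in> borel_measurable borel"
  proof (rule borel_measurableI_greater)
    fix a :: ereal
    have "{z. a < S z} = (\<Union>t\<in>T. {z. a < ereal \<bar>(\<Sum>i\<in>I. z i * g i t) - c t\<bar>})"
      by (auto simp: S_def less_SUP_iff)
    moreover have "open {z :: 'i \<Rightarrow> real. a < ereal \<bar>(\<Sum>i\<in>I. z i * g i t) - c t\<bar>}" for t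
      by (intro open_Collect_less continuous_on_ereal continuous_intros continuous_on_product_coordinates)
    ultimately have "open {z. a < S z}" by auto
    then show "{z \<in> space borel. a < S z} \<in> sets borel" by simp
  qed
  moreover have "\<psi> \<in> N \<rightarrow>\<^sub>M borel"
  proof -
    \<comment> \<open>The index type is countable, so the Borel sets of the product topology are
      those of the product sigma algebra and measurability can be checked by coordinates.\<close>
    have "\<psi> \<in> N \<rightarrow>\<^sub>M PiM UNIV (\<lambda>_. borel)"
    proof (rule measurable_PiM_single')
      show "(\<lambda>\<omega>. \<psi> \<omega> i) \<in> borel_measurable N" for i
        using X by (cases "i \<in> I") (auto simp: \<psi>_def)
    qed auto
    then show ?thesis
      by (subst measurable_cong_sets[OF refl sets_PiM_equal_borel[symmetric]])
  qed
  ultimately have "(\<lambda>\<omega>. S (\<psi> \<omega>)) \<in> borel_measurable N"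
    by (rule measurable_compose[rotated])
  then show ?thesis by (simp add: S_def \<psi>_def cong: sum.cong)
qed


section \<open>Gaussian tails\<close>

text \<open>On the tail, half of the Gaussian exponent is bounded through \<open>a\<close>. The
  other half is, up to the factor \<open>sqrt 2\<close>, a normal density of doubled variance, which
  has mass one.\<close>

lemma (in prob_space) normal_abs_tail:
  assumes X: "distributed M lborel X (normal_density 0 \<sigma>)" and "\<sigma> > 0" "a \<ge> 0"
  shows "prob {\<omega> \<in> space M. a < \<bar>X \<omega>\<bar>} \<le> sqrt 2 * exp (- (a\<^sup>2 / (4 * \<sigma>\<^sup>2)))"
proof -
  define c where "c = sqrt 2 * exp (- (a\<^sup>2 / (4 * \<sigma>\<^sup>2)))"
  have c: "c \<ge> 0" by (simp add: c_def)
  let ?S = "{x::real. a < \<bar>x\<bar>}"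
  have S: "?S \<in> sets lborel" by measurable
  have dens: "normal_density 0 \<sigma> x \<le> c * normal_density 0 (sqrt 2 * \<sigma>) x" if "x \<in> ?S" for x
  proof -
    have "a\<^sup>2 \<le> x\<^sup>2" using that \<open>a \<ge> 0\<close> by (intro abs_le_square_iff[THEN iffD1]) auto
    then have "- (x\<^sup>2 / (2 * \<sigma>\<^sup>2)) \<le> - (a\<^sup>2 / (4 * \<sigma>\<^sup>2)) - x\<^sup>2 / (4 * \<sigma>\<^sup>2)"
      using \<open>\<sigma> > 0\<close> by (simp add: field_simps)
    then have "exp (- (x\<^sup>2 / (2 * \<sigma>\<^sup>2))) \<le> exp (- (a\<^sup>2 / (4 * \<sigma>\<^sup>2))) * exp (- (x\<^sup>2 / (4 * \<sigma>\<^sup>2)))"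
      by (simp add: exp_add[symmetric])
    then have "exp (- (x\<^sup>2 / (2 * \<sigma>\<^sup>2))) / sqrt (2 * pi * \<sigma>\<^sup>2)
        \<le> exp (- (a\<^sup>2 / (4 * \<sigma>\<^sup>2))) * exp (- (x\<^sup>2 / (4 * \<sigma>\<^sup>2))) / sqrt (2 * pi * \<sigma>\<^sup>2)"
      by (intro divide_right_mono) auto
    also have "\<dots> = c * normal_density 0 (sqrt 2 * \<sigma>) x"
      using \<open>\<sigma> > 0\<close> by (simp add: normal_density_def c_def power_mult_distrib real_sqrt_mult field_simps)
    finally show ?thesis by (simp add: normal_density_def)
  qed
  have "emeasure M {\<omega> \<in> space M. a < \<bar>X \<omega>\<bar>} = (\<integral>\<^sup>+x. ennreal (normal_density 0 \<sigma> x) * indicator ?S x \<partial>lborel)"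
    using distributed_emeasure[OF X S] by (simp add: vimage_def Int_def conj_commute)
  also have "\<dots> \<le> (\<integral>\<^sup>+x. ennreal c * ennreal (normal_density 0 (sqrt 2 * \<sigma>) x) \<partial>lborel)"
    using dens c by (intro nn_integral_mono)
      (auto simp: indicator_def ennreal_mult[symmetric] intro!: ennreal_leI)
  also have "\<dots> = ennreal c * (\<integral>\<^sup>+x. ennreal (normal_density 0 (sqrt 2 * \<sigma>) x) \<partial>lborel)"
    by (intro nn_integral_cmult) measurable
  also have "(\<integral>\<^sup>+x. ennreal (normal_density 0 (sqrt 2 * \<sigma>) x) \<partial>lborel) = 1"
    using \<open>\<sigma> > 0\<close> by (subst nn_integral_eq_integral) auto
  finally have "emeasure M {\<omega> \<in> space M. a < \<bar>X \<omega>\<bar>} \<le> ennreal c" by simp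
  then show ?thesis
    using c unfolding c_def[symmetric] by (simp add: emeasure_eq_measure)
qed


section \<open>Choice of the resolution level\<close>

text \<open>The order of the uniform stochastic error at resolution level \<open>j\<close>; \<nu>
  collects the noise level, the logarithmic factor and constants.\<close>

definition noise :: "real \<Rightarrow> nat \<Rightarrow> real" where
  "noise \<nu> j = \<nu> * 2 powr (real j / 2)"

text \<open>Extrapolation of a bound \<open>\<epsilon> * B * 2 powr (- k * \<gamma>) \<le> E\<close> from level \<open>k\<close> to level \<open>j\<close> without
  \<open>\<gamma>\<close>: the factor \<open>2 powr (- (j - k) * \<gamma>)\<close> is the power \<open>(j - k) / k\<close> of
  \<open>2 powr (- k * \<gamma>) \<le> E / (\<epsilon> * Blow)\<close>.\<close>
definition bias_bound :: "real \<Rightarrow> real \<Rightarrow> nat \<Rightarrow> nat \<Rightarrow> real \<Rightarrow> real" where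
  "bias_bound \<epsilon> Blow k j E = E / \<epsilon> * (E / (\<epsilon> * Blow)) powr ((real j - real k) / real k)"

text \<open>The alternative \<open>jmax \<le> j\<close> makes the minimum exist for all data. Where
  it alone stops the search, nothing is claimed about \<open>P\<close>.\<close>

definition select_level :: "nat \<Rightarrow> nat \<Rightarrow> (nat \<Rightarrow> bool) \<Rightarrow> nat" where
  "select_level jmin jmax P = (LEAST j. jmin \<le> j \<and> (jmax \<le> j \<or> P j))"

lemma noise_nonneg: "\<nu> \<ge> 0 \<Longrightarrow> noise \<nu> j \<ge> 0"
  by (simp add: noise_def)

lemma noise_mono: "\<nu> \<ge> 0 \<Longrightarrow> i \<le> j \<Longrightarrow> noise \<nu> i \<le> noise \<nu> j"
  unfolding noise_def by (intro mult_left_mono powr_mono) auto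

lemma select_level_le:
  assumes "P j" "jmin \<le> j" "j \<le> jmax"
  shows "select_level jmin jmax P \<le> j" "P (select_level jmin jmax P)" "jmin \<le> select_level jmin jmax P"
proof -
  let ?Q = "\<lambda>j. jmin \<le> j \<and> (jmax \<le> j \<or> P j)"
  show le: "select_level jmin jmax P \<le> j"
    unfolding select_level_def using assms by (intro Least_le) auto
  have "?Q (select_level jmin jmax P)"
    unfolding select_level_def using assms by (intro LeastI[of ?Q j]) auto
  \<comment> \<open>If the search stops by reaching \<open>jmax\<close>, then the selected level
    equals \<open>j\<close>, where \<open>P\<close> holds by assumption.\<close>
  then show "P (select_level jmin jmax P)" "jmin \<le> select_level jmin jmax P"
    using le assms by (auto dest: order_antisym)
qed

lemma bias_bound_ge:
  assumes "0 < \<epsilon>" "0 < Blow" "Blow \<le> B" "0 < k" "k \<le> j"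
    and E: "\<epsilon> * B * 2 powr (- (real k * \<gamma>)) \<le> E"
  shows "B * 2 powr (- (real j * \<gamma>)) \<le> bias_bound \<epsilon> Blow k j E"
proof -
  let ?d = "(real j - real k) / real k"
  let ?p = "2 powr (- (real k * \<gamma>)) :: real"
  have E': "B * ?p \<le> E / \<epsilon>"
    using E \<open>0 < \<epsilon>\<close> by (simp add: field_simps)
  have "Blow * ?p \<le> B * ?p" using assms by (intro mult_right_mono) auto
  also note E'
  finally have p: "?p \<le> E / (\<epsilon> * Blow)"
    using \<open>0 < \<epsilon>\<close> \<open>0 < Blow\<close> by (simp add: field_simps)
  \<comment> \<open>The decay from level \<open>k\<close> to level \<open>j\<close> is written as a
    power of the decay down to level \<open>k\<close>, with an exponent free of \<gamma>.\<close>
  have "- (real j * \<gamma>) = - (real k * \<gamma>) + - (real k * \<gamma>) * ?d"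
    using \<open>0 < k\<close> by (simp add: field_simps)
  then have "B * 2 powr (- (real j * \<gamma>)) = (B * ?p) * ?p powr ?d"
    by (simp only: powr_add powr_powr mult.assoc)
  also have "\<dots> \<le> E / \<epsilon> * (E / (\<epsilon> * Blow)) powr ?d"
    using assms E' p by (intro mult_mono powr_mono2) (auto intro: order_trans[OF _ E'])
  finally show ?thesis by (simp add: bias_bound_def)
qed

text \<open>Weighted geometric mean of the noise with itself, with weights adding to one; bounding
  one factor by the bias makes the powers of \<open>2 powr (i / 2)\<close> cancel.\<close>

lemma noise_le_rate:
  assumes "\<nu> > 0" "a > 0" "\<gamma> > 0" and le: "noise \<nu> i \<le> a * 2 powr (- (real i * \<gamma>))"
  shows "noise \<nu> i \<le> a powr (1 / (2 * \<gamma> + 1)) * \<nu> powr (2 * \<gamma> / (2 * \<gamma> + 1))"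
proof -
  define X where "X = (2::real) powr (real i / 2)"
  have X: "X > 0" by (simp add: X_def)
  let ?q = "1 / (2 * \<gamma> + 1)" and ?r = "2 * \<gamma> / (2 * \<gamma> + 1)"
  have qr: "?q + ?r = 1" using \<open>\<gamma> > 0\<close> by (simp add: add_divide_distrib[symmetric])
  have pow: "2 powr (- (real i * \<gamma>)) = X powr (- (2 * \<gamma>))"
    by (simp add: X_def powr_powr)
  have N: "noise \<nu> i = \<nu> * X" by (simp add: noise_def X_def)
  have "\<nu> * X = (\<nu> * X) powr ?q * (\<nu> * X) powr ?r"
    using \<open>\<nu> > 0\<close> X by (simp add: powr_add[symmetric] qr)
  also have "\<dots> \<le> (a * X powr (- (2 * \<gamma>))) powr ?q * (\<nu> * X) powr ?r"
    using le \<open>\<nu> > 0\<close> X \<open>\<gamma> > 0\<close> unfolding N pow by (intro mult_right_mono powr_mono2) auto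
  also have "\<dots> = a powr ?q * \<nu> powr ?r * (X powr (- ?r) * X powr ?r)"
    using \<open>\<nu> > 0\<close> \<open>a > 0\<close> X by (simp add: powr_mult powr_powr)
  also have "X powr (- ?r) * X powr ?r = 1"
    using X by (simp add: powr_minus)
  finally show ?thesis by (simp add: N)
qed

text \<open>The witness is the first level at which the noise dominates the bias by the factor
  \<open>2 * C\<^sub>1 / \<epsilon>\<close>. A fixed number \<open>g\<close> of levels below it the bias is still visible in \<open>E\<close>, and
  extrapolating over \<open>g\<close> levels loses at most a factor \<open>2\<close>.\<close>
lemma bias_bound_resolved:
  assumes pos: "0 < \<epsilon>" "0 < Blow" "0 < C\<^sub>1" "0 < \<kappa>" "0 < \<nu>" "0 < jmin"
    and B: "Blow \<le> B" "B \<le> Bup" and \<gamma>: "0 < \<gamma>" "\<gamma> \<le> \<gamma>up"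
    and E_nonneg: "\<And>k. jmin \<le> k \<Longrightarrow> k \<le> jmax \<Longrightarrow> 0 \<le> E k"
    and E: "\<And>k. jmin \<le> k \<Longrightarrow> k \<le> jmax \<Longrightarrow> 2 * \<kappa> * noise \<nu> (k + lag) \<le> B * 2 powr (- (real k * \<gamma>)) \<Longrightarrow>
       E k \<le> C\<^sub>1 * B * 2 powr (- (real k * \<gamma>))"
    and g: "4 * \<kappa> * C\<^sub>1 / \<epsilon> * 2 powr ((real lag + 1 - real g) / 2) \<le> 1" "0 < g"
    and m0: "jmin + g \<le> m0" "m0 \<le> jmax"
      "max 1 (C\<^sub>1 * Bup / (\<epsilon> * Blow)) powr (real g / (real m0 - real g)) \<le> 2"
      "noise \<nu> m0 < 2 * C\<^sub>1 * Blow / \<epsilon> * 2 powr (- (real m0 * \<gamma>up))"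
    and jmax: "2 * C\<^sub>1 * Bup / \<epsilon> \<le> noise \<nu> jmax"
  shows "\<exists>j. jmin \<le> j \<and> j \<le> jmax \<and> (\<exists>k\<in>{jmin..j}. bias_bound \<epsilon> Blow k j (E k) \<le> noise \<nu> j) \<and>
    noise \<nu> j \<le> sqrt 2 * ((2 * C\<^sub>1 * B / \<epsilon>) powr (1 / (2 * \<gamma> + 1)) * \<nu> powr (2 * \<gamma> / (2 * \<gamma> + 1)))"
proof -
  define a where "a = 2 * C\<^sub>1 * B / \<epsilon>"
  define P where "P j \<longleftrightarrow> a * 2 powr (- (real j * \<gamma>)) \<le> noise \<nu> j" for j
  have "B > 0" using pos B by linarith
  then have a: "a > 0" using pos by (simp add: a_def)
  \<comment> \<open>At \<open>jmax\<close> the noise exceeds \<open>a\<close>, hence every bias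
    term, so a balancing level exists.\<close>
  have "P jmax"
  proof -
    have "a * 2 powr (- (real jmax * \<gamma>)) \<le> a * 1"
      using a \<gamma> by (intro mult_left_mono) (auto simp: powr_minus inverse_le_1_iff ge_one_powr_ge_zero)
    also have "\<dots> \<le> 2 * C\<^sub>1 * Bup / \<epsilon>"
      using pos B by (auto simp: a_def intro!: divide_right_mono)
    finally show ?thesis using jmax by (simp add: P_def)
  qed
  define j where "j = (LEAST j. P j)"
  have "P j" unfolding j_def using \<open>P jmax\<close> by (rule LeastI)
  have "j \<le> jmax" unfolding j_def using \<open>P jmax\<close> by (rule Least_le)
  \<comment> \<open>Up to \<open>m0\<close> the bias dominates for every \<gamma> and
    \<open>B\<close> in the range, which forces \<open>j\<close> to be large and the extrapolation
    exponent to be small.\<close>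
  have "\<not> P i" if "i \<le> m0" for i
  proof -
    have "noise \<nu> i \<le> noise \<nu> m0" using pos that by (intro noise_mono) auto
    also have "\<dots> < 2 * C\<^sub>1 * Blow / \<epsilon> * 2 powr (- (real m0 * \<gamma>up))" by (rule m0)
    also have "\<dots> \<le> a * 2 powr (- (real i * \<gamma>))"
    proof (rule mult_mono)
      show "2 * C\<^sub>1 * Blow / \<epsilon> \<le> a" using pos B by (auto simp: a_def intro!: divide_right_mono)
      have "real i * \<gamma> \<le> real m0 * \<gamma>up" using that \<gamma> by (intro mult_mono) auto
      then show "2 powr (- (real m0 * \<gamma>up)) \<le> (2::real) powr (- (real i * \<gamma>))"
        by (intro powr_mono) auto
    qed (use a in auto)
    finally show ?thesis by (simp add: P_def)
  qed
  then have "m0 < j" using \<open>P j\<close> not_le by blast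
  define i where "i = j - 1"
  have j: "j = Suc i" using \<open>m0 < j\<close> by (simp add: i_def)
  \<comment> \<open>One level below the minimum the bias still dominates. This bounds the noise
    there by the rate, and going up one level costs a factor \<open>sqrt 2\<close>.\<close>
  have "\<not> P i" using not_less_Least[of i P] j by (simp add: j_def)
  then have Ni: "noise \<nu> i \<le> a * 2 powr (- (real i * \<gamma>))" by (simp add: P_def)
  have shift: "noise \<nu> (i + m) = noise \<nu> i * 2 powr (real m / 2)" for m
    by (simp add: noise_def add_divide_distrib powr_add)
  have "noise \<nu> j = noise \<nu> i * sqrt 2"
    using shift[of 1] by (simp add: j powr_half_sqrt)
  also have "\<dots> \<le> a powr (1 / (2 * \<gamma> + 1)) * \<nu> powr (2 * \<gamma> / (2 * \<gamma> + 1)) * sqrt 2"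
    using noise_le_rate[OF _ a _ Ni] pos \<gamma> by (intro mult_right_mono) auto
  finally have rate: "noise \<nu> j
      \<le> sqrt 2 * (a powr (1 / (2 * \<gamma> + 1)) * \<nu> powr (2 * \<gamma> / (2 * \<gamma> + 1)))"
    by (simp add: mult.commute)
  define k where "k = j - g"
  have jk: "j = k + g" using \<open>m0 < j\<close> m0 by (simp add: k_def)
  have k: "jmin \<le> k" "k \<le> j" "0 < k" "k \<le> jmax"
    using \<open>m0 < j\<close> m0 \<open>j \<le> jmax\<close> pos by (auto simp: k_def)
  have kj: "k + lag + g = i + 1 + lag" using jk j by simp
  \<comment> \<open>Levels \<open>k + lag\<close> and \<open>i\<close> differ by
    \<open>lag + 1 - g\<close>, so the hypothesis on \<open>g\<close> keeps the noise at
    \<open>k + lag\<close> below the bias at \<open>k\<close>.\<close>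
  have "2 * \<kappa> * noise \<nu> (k + lag) = 2 * \<kappa> * (noise \<nu> i * 2 powr ((real lag + 1 - real g) / 2))"
  proof -
    have "real (k + lag) / 2 = real i / 2 + (real lag + 1 - real g) / 2"
      using arg_cong[OF kj, of real] by (simp add: field_simps)
    then show ?thesis unfolding noise_def by (simp only: powr_add mult.assoc)
  qed
  also have "\<dots> \<le> 2 * \<kappa> * (a * 2 powr (- (real i * \<gamma>)) * 2 powr ((real lag + 1 - real g) / 2))"
    using pos Ni by (intro mult_left_mono mult_right_mono) auto
  also have "\<dots> = (4 * \<kappa> * C\<^sub>1 / \<epsilon> * 2 powr ((real lag + 1 - real g) / 2)) * (B * 2 powr (- (real i * \<gamma>)))"
    by (simp add: a_def field_simps)
  also have "\<dots> \<le> 1 * (B * 2 powr (- (real i * \<gamma>)))"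
    using g \<open>B > 0\<close> by (intro mult_right_mono) auto
  also have "\<dots> \<le> B * 2 powr (- (real k * \<gamma>))"
    using \<open>B > 0\<close> g \<gamma> jk j by (auto intro!: mult_left_mono powr_mono mult_right_mono)
  finally have E_k: "E k \<le> C\<^sub>1 * B * 2 powr (- (real k * \<gamma>))"
    using k by (intro E)
  have "bias_bound \<epsilon> Blow k j (E k) \<le> noise \<nu> j"
  proof -
    let ?p = "2 powr (- (real k * \<gamma>)) :: real"
    let ?q = "C\<^sub>1 * Bup / (\<epsilon> * Blow)"
    let ?d = "real g / real k"
    have d: "(real j - real k) / real k = ?d" by (simp add: jk)
    have "E k / (\<epsilon> * Blow) \<le> C\<^sub>1 * B * ?p / (\<epsilon> * Blow)"
      using pos by (intro divide_right_mono E_k) auto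
    also have "\<dots> \<le> C\<^sub>1 * Bup * ?p / (\<epsilon> * Blow)"
      using pos B by (intro divide_right_mono mult_right_mono mult_left_mono) auto
    also have "\<dots> = ?q * ?p" by simp
    also have "\<dots> \<le> max 1 ?q * ?p"
      by (intro mult_right_mono) auto
    finally have "(E k / (\<epsilon> * Blow)) powr ?d \<le> (max 1 ?q * ?p) powr ?d"
      using pos k E_nonneg[of k] by (intro powr_mono2) auto
    also have "\<dots> = max 1 ?q powr ?d * 2 powr (- (real g * \<gamma>))"
      using \<open>0 < k\<close> by (simp add: powr_mult powr_powr mult.commute)
    \<comment> \<open>Since \<open>j\<close> exceeds \<open>m0\<close>, \<open>k\<close> exceeds
      \<open>m0 - g\<close>, and the exponent decreases in \<open>k\<close>; the base is at least
      one because of the maximum.\<close>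
    also have "max 1 ?q powr ?d \<le> max 1 ?q powr (real g / (real m0 - real g))"
      using m0 \<open>m0 < j\<close> jk pos by (intro powr_mono divide_left_mono mult_pos_pos) auto
    also have "\<dots> \<le> 2" by (rule m0)
    finally have ext: "(E k / (\<epsilon> * Blow)) powr ?d \<le> 2 * 2 powr (- (real g * \<gamma>))"
      by simp
    have "bias_bound \<epsilon> Blow k j (E k) \<le> (C\<^sub>1 * B * ?p / \<epsilon>) * (2 * 2 powr (- (real g * \<gamma>)))"
      unfolding bias_bound_def d using pos ext E_k k E_nonneg[of k] \<open>B > 0\<close>
      by (intro mult_mono divide_right_mono) auto
    \<comment> \<open>The factor 2 lost in the extrapolation is the 2 in \<open>a\<close>, so the
      bound is exactly the bias threshold in \<open>P j\<close>.\<close>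
    also have "\<dots> = a * (?p * 2 powr (- (real g * \<gamma>)))"
      by (simp add: a_def)
    also have "?p * 2 powr (- (real g * \<gamma>)) = 2 powr (- (real j * \<gamma>))"
      by (simp add: jk powr_add[symmetric] algebra_simps)
    also have "a * \<dots> \<le> noise \<nu> j" using \<open>P j\<close> by (simp add: P_def)
    finally show ?thesis .
  qed
  with rate k \<open>j \<le> jmax\<close> show ?thesis
    unfolding a_def by (intro exI[of _ j]) auto
qed


section \<open>The estimator\<close>

definition obs_grid :: "real \<Rightarrow> nat \<Rightarrow> int set" where
  "obs_grid \<eta> j = {i. - \<eta> \<le> of_int i / 2 ^ j \<and> of_int i / 2 ^ j \<le> 1 + \<eta>}"

text \<open>The factor \<open>2 ^ j\<close> is the chain rule for the rescaling to an integer grid.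
  As a function of the path this is a linear combination of finitely many observations, which yields
  measurability of suprema over \<open>x\<close>.\<close>

definition estimator :: "nat \<Rightarrow> real \<Rightarrow> nat \<Rightarrow> (real \<Rightarrow> real) \<Rightarrow> real \<Rightarrow> real" where
  "estimator D \<eta> j y x = (\<Sum>i\<in>obs_grid \<eta> j. y (of_int i / 2 ^ j) * (2 ^ j * diff_weight D i (2 ^ j * x)))"

lemma obs_grid_subset: "obs_grid \<eta> j \<subseteq> {\<lceil>- \<eta> * 2 ^ j\<rceil>..\<lfloor>(1 + \<eta>) * 2 ^ j\<rfloor>}"
  unfolding obs_grid_def by (intro subsetI) (simp only: mem_Collect_eq atLeastAtMost_iff ceiling_le_iff le_floor_iff pos_le_divide_eq pos_divide_le_eq zero_less_power zero_less_numeral simp_thms)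

lemma finite_obs_grid [simp]: "finite (obs_grid \<eta> j)"
  by (rule finite_subset[OF obs_grid_subset]) simp

lemma card_obs_grid_le:
  assumes "\<eta> > 0"
  shows "real (card (obs_grid \<eta> j)) \<le> (2 + 2 * \<eta>) * 2 ^ j"
proof -
  define a b where "a = \<lceil>- \<eta> * 2 ^ j\<rceil>" and "b = \<lfloor>(1 + \<eta>) * 2 ^ j\<rfloor>"
  have "real (card (obs_grid \<eta> j)) \<le> real (card {a..b})"
    unfolding a_def b_def by (intro of_nat_mono card_mono obs_grid_subset) simp
  also have "\<dots> \<le> (1 + 2 * \<eta>) * 2 ^ j + 1"
  proof -
    have "- \<eta> * 2 ^ j \<le> of_int a" "of_int b \<le> (1 + \<eta>) * 2 ^ j"
      unfolding a_def b_def by (rule le_of_int_ceiling, rule of_int_floor_le)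
    then have "of_int (b + 1 - a) \<le> (1 + 2 * \<eta>) * 2 ^ j + 1"
      by (simp add: algebra_simps)
    moreover have "0 \<le> (1 + 2 * \<eta>) * 2 ^ j + 1" using assms by simp
    ultimately show ?thesis by simp
  qed
  finally have "real (card (obs_grid \<eta> j)) \<le> (1 + 2 * \<eta>) * 2 ^ j + 1" .
  moreover have "(2 + 2 * \<eta>) * 2 ^ j = (1 + 2 * \<eta>) * 2 ^ j + 2 ^ j"
    by (simp add: algebra_simps)
  moreover have "(1::real) \<le> 2 ^ j" by simp
  ultimately show ?thesis by linarith
qed

text \<open>The nodes used at \<open>x\<close> reach at most one spacing to the left and
  \<open>D\<close> to the right, so points slightly outside the unit interval can still be estimated
  from observed values.\<close>

lemma floor_window_subset_obs_grid:
  assumes "- \<rho> \<le> x" "x \<le> 1 + \<rho>" "\<rho> + real D / 2 ^ j \<le> \<eta>" "0 < D"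
  shows "{\<lfloor>2 ^ j * x\<rfloor>..\<lfloor>2 ^ j * x\<rfloor> + int D} \<subseteq> obs_grid \<eta> j"
proof
  fix i assume i: "i \<in> {\<lfloor>2 ^ j * x\<rfloor>..\<lfloor>2 ^ j * x\<rfloor> + int D}"
  then have "2 ^ j * x - 1 \<le> of_int i" "of_int i \<le> 2 ^ j * x + real D"
    by (auto; linarith)+
  then have "(2 ^ j * x - 1) / 2 ^ j \<le> of_int i / 2 ^ j" "of_int i / 2 ^ j \<le> (2 ^ j * x + real D) / 2 ^ j"
    by (auto intro!: divide_right_mono)
  then have "x - 1 / 2 ^ j \<le> of_int i / 2 ^ j" "of_int i / 2 ^ j \<le> x + real D / 2 ^ j"
    by (simp_all add: diff_divide_distrib add_divide_distrib)
  moreover have "1 / 2 ^ j \<le> real D / 2 ^ j"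
    using \<open>0 < D\<close> by (intro divide_right_mono) auto
  ultimately show "i \<in> obs_grid \<eta> j"
    using assms by (auto simp: obs_grid_def)
qed

text \<open>A deterministic estimate: by linearity the estimator splits into a part from
  \<open>F\<close>, whose error is the bias, and a part from \<open>w\<close>, controlled by its
  grid increments alone. The factor \<open>2 ^ j\<close> times increments of order
  \<open>2 powr (- j / 2)\<close> gives the growth of the noise.\<close>

lemma estimator_error:
  assumes f: "f \<in> holder_class \<gamma> B" and "\<gamma> > 0" "B \<ge> 0" "s \<ge> 0" "q \<ge> 0"
    and F: "\<And>t. (F has_real_derivative f t) (at t)"
    and D: "strict_floor \<gamma> < D" "\<gamma> \<le> \<gamma>'"
    and A: "\<And>i u. \<bar>diff_weight D i u\<bar> \<le> A"
    and window: "{\<lfloor>2 ^ j * x\<rfloor>..\<lfloor>2 ^ j * x\<rfloor> + int D} \<subseteq> obs_grid \<eta> j"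
    and y: "\<And>p. - \<eta> \<le> p \<Longrightarrow> p \<le> 1 + \<eta> \<Longrightarrow> y p = F p + s * w p"
    and w: "\<And>i. i \<in> obs_grid \<eta> j \<Longrightarrow>
      \<bar>w (of_int (i + 1) / 2 ^ j) - w (of_int i / 2 ^ j)\<bar> \<le> q * 2 powr (- (real j / 2))"
  shows "\<bar>estimator D \<eta> j y x - f x\<bar>
    \<le> (real D + 1) * A * real D powr (\<gamma>' + 1) * B * 2 powr (- (real j * \<gamma>))
      + noise ((real D + 1) * A * real D * q * s) j"
proof -
  let ?I = "obs_grid \<eta> j" and ?u = "2 ^ j * x"
  define SF where "SF = (\<Sum>i\<in>?I. diff_weight D i ?u * F (of_int i / 2 ^ j))"
  define SW where "SW = (\<Sum>i\<in>?I. diff_weight D i ?u * w (of_int i / 2 ^ j))"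
  have "estimator D \<eta> j y x
      = (\<Sum>i\<in>?I. (F (of_int i / 2 ^ j) + s * w (of_int i / 2 ^ j)) * (2 ^ j * diff_weight D i ?u))"
    unfolding estimator_def by (intro sum.cong refl) (simp add: obs_grid_def y)
  also have "\<dots> = 2 ^ j * SF + 2 ^ j * s * SW"
    by (simp add: SF_def SW_def algebra_simps sum.distrib sum_distrib_left)
  finally have est: "estimator D \<eta> j y x = 2 ^ j * SF + 2 ^ j * s * SW" .
  have "\<bar>2 ^ j * SF - f x\<bar>
      \<le> (real D + 1) * A * real D powr (\<gamma>' + 1) * B * (1 / 2 ^ j) powr \<gamma>"
    using sum_diff_weight_primitive[OF f \<open>\<gamma> > 0\<close> \<open>B \<ge> 0\<close> _ F D A finite_obs_grid,
        where h = "1 / 2 ^ j" and x = x and \<eta>1 = \<eta> and j1 = j] window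
    by (simp add: SF_def mult.commute)
  also have "(1 / 2 ^ j) powr \<gamma> = 2 powr (- (real j * \<gamma>))"
    by (simp add: powr_realpow[symmetric] powr_divide powr_powr powr_minus_divide)
  finally have bias: "\<bar>2 ^ j * SF - f x\<bar>
      \<le> (real D + 1) * A * real D powr (\<gamma>' + 1) * B * 2 powr (- (real j * \<gamma>))" .
  have "\<bar>SW\<bar> \<le> (real D + 1) * A * (real D * (q * 2 powr (- (real j / 2))))"
    unfolding SW_def using \<open>q \<ge> 0\<close> w by (intro sum_diff_weight_increments[OF A _ _ window]) auto
  then have "2 ^ j * s * \<bar>SW\<bar> \<le> 2 ^ j * s * ((real D + 1) * A * (real D * (q * 2 powr (- (real j / 2)))))"
    using \<open>s \<ge> 0\<close> by (intro mult_left_mono) auto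
  also have "\<dots> = (real D + 1) * A * real D * q * s * (2 powr real j * 2 powr (- (real j / 2)))"
    by (simp add: powr_realpow)
  also have "\<dots> = noise ((real D + 1) * A * real D * q * s) j"
    by (simp add: noise_def powr_add[symmetric])
  finally have "\<bar>2 ^ j * s * SW\<bar> \<le> noise ((real D + 1) * A * real D * q * s) j"
    using \<open>s \<ge> 0\<close> by (simp add: abs_mult)
  then show ?thesis using bias unfolding est by linarith
qed

lemma estimator_borel_measurable [measurable]: "estimator D \<eta> j y \<in> borel_measurable borel"
  unfolding estimator_def[abs_def] by measurable

lemma estimator_path_measurable:
  assumes "\<And>p. - \<eta> \<le> p \<Longrightarrow> p \<le> 1 + \<eta> \<Longrightarrow> (\<lambda>\<omega>. Y \<omega> p) \<in> borel_measurable N"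
  shows "(\<lambda>\<omega>. estimator D \<eta> j (Y \<omega>) x) \<in> borel_measurable N"
  unfolding estimator_def using assms
  by (intro borel_measurable_sum borel_measurable_times borel_measurable_const) (auto simp: obs_grid_def)


section \<open>The confidence band\<close>

lemma Sup_Inf_ereal_Icc:
  assumes "0 \<le> w"
  shows "Sup (ereal ` {c - w..c + w}) = ereal (c + w)" "Inf (ereal ` {c - w..c + w}) = ereal (c - w)"
  using assms by (auto intro!: cSup_eq_maximum cInf_eq_minimum)

lemma interval_length_Icc: "0 \<le> w \<Longrightarrow> interval_length {c - w..c + w} = ereal (2 * w)"
  by (simp add: interval_length_def Sup_Inf_ereal_Icc)

lemma path_space_measurable: "- \<eta> \<le> p \<Longrightarrow> p \<le> 1 + \<eta> \<Longrightarrow> (\<lambda>y. y p) \<in> borel_measurable (path_space \<eta>)"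
  unfolding path_space_def by (intro measurable_restrict_space1 measurable_component_singleton) auto

text \<open>\<open>Cb\<close> is the constant in the bias of the estimator, \<open>lag\<close> the
  number of levels by which the estimator tested against the kernel is finer, and
  \<open>jmin\<close> and \<open>jmax\<close> delimit the search.\<close>

locale adaptive_band = compact_kernel +
  fixes D lag jmin jmax :: nat and \<eta> \<epsilon> Blow \<nu> Cb :: real
begin

text \<open>The factor 2 compensates for the bias of the estimator, which may hide up to half of the
  self-similarity signal.\<close>

definition smoothed_error :: "nat \<Rightarrow> (real \<Rightarrow> real) \<Rightarrow> real" where
  "smoothed_error k y = 2 * (real_of_ereal (approx_error K (int k) (estimator D \<eta> (k + lag) y))
     + (1 + L1_bound) * noise \<nu> (k + lag))"

definition level :: "(real \<Rightarrow> real) \<Rightarrow> nat" where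
  "level y = select_level jmin jmax
     (\<lambda>j. \<exists>k\<in>{jmin..j}. bias_bound \<epsilon> Blow k j (smoothed_error k y) \<le> noise \<nu> j)"

text \<open>One \<open>noise\<close> for the stochastic error and \<open>Cb\<close> times it for the
  bias, which the selection rule keeps below that multiple.\<close>

definition halfwidth :: "(real \<Rightarrow> real) \<Rightarrow> real" where
  "halfwidth y = (1 + Cb) * noise \<nu> (level y)"

definition band :: "real \<Rightarrow> (real \<Rightarrow> real) \<Rightarrow> real set" where
  "band x y = {estimator D \<eta> (level y) y x - halfwidth y..estimator D \<eta> (level y) y x + halfwidth y}"

text \<open>Brings the error into the form of a supremum of linear combinations of grid
  observations, as measurability requires; the trailing zero is the offset \<open>c t\<close> of
  that form.\<close>

lemma approx_error_estimator:
  "approx_error K (int k) (estimator D \<eta> j y)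
    = (SUP t\<in>{0..1}. ereal \<bar>(\<Sum>i\<in>obs_grid \<eta> j. y (of_int i / 2 ^ j) *
        (kernel_approx K (int k) (\<lambda>x. 2 ^ j * diff_weight D i (2 ^ j * x)) t
          - 2 ^ j * diff_weight D i (2 ^ j * t))) - 0\<bar>)"
proof -
  obtain A where "A > 0" and A: "\<And>i u. \<bar>diff_weight D i u\<bar> \<le> A"
    by (rule diff_weight_bounded[of D]) (rule that)
  have "kernel_approx K (int k) (estimator D \<eta> j y) t = (\<Sum>i\<in>obs_grid \<eta> j. y (of_int i / 2 ^ j) *
        kernel_approx K (int k) (\<lambda>x. 2 ^ j * diff_weight D i (2 ^ j * x)) t)" for t
    unfolding estimator_def[abs_def]
  proof (rule kernel_approx_sum)
    show "\<bar>2 ^ j * diff_weight D i (2 ^ j * x)\<bar> \<le> 2 ^ j * A" for i x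
      by (simp add: abs_mult A)
  qed simp_all
  then have "kernel_approx K (int k) (estimator D \<eta> j y) t - estimator D \<eta> j y t
      = (\<Sum>i\<in>obs_grid \<eta> j. y (of_int i / 2 ^ j) *
        (kernel_approx K (int k) (\<lambda>x. 2 ^ j * diff_weight D i (2 ^ j * x)) t
          - 2 ^ j * diff_weight D i (2 ^ j * t))) - 0" for t
    unfolding estimator_def[of D \<eta> j y t] right_diff_distrib sum_subtractf by simp
  then show ?thesis
    unfolding approx_error_def by (simp only:)
qed

section \<open>Measurability of the selected level, the halfwidth and the errors\<close>

context
  fixes N :: "'b measure" and Y :: "'b \<Rightarrow> real \<Rightarrow> real"
  assumes Y: "\<And>p. - \<eta> \<le> p \<Longrightarrow> p \<le> 1 + \<eta> \<Longrightarrow> (\<lambda>\<omega>. Y \<omega> p) \<in> borel_measurable N"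
begin

lemma smoothed_error_measurable: "(\<lambda>\<omega>. smoothed_error k (Y \<omega>)) \<in> borel_measurable N"
proof -
  have "(\<lambda>\<omega>. approx_error K (int k) (estimator D \<eta> (k + lag) (Y \<omega>))) \<in> borel_measurable N"
    unfolding approx_error_estimator
    by (rule borel_measurable_SUP_linear_combination) (auto simp: obs_grid_def intro: Y)
  then show ?thesis unfolding smoothed_error_def by measurable
qed

lemma level_measurable: "(\<lambda>\<omega>. level (Y \<omega>)) \<in> N \<rightarrow>\<^sub>M count_space UNIV"
proof -
  have [measurable]: "(\<lambda>\<omega>. smoothed_error k (Y \<omega>)) \<in> borel_measurable N" for k
    by (rule smoothed_error_measurable)
  show ?thesis unfolding level_def select_level_def bias_bound_def by measurable
qed

lemma halfwidth_measurable: "(\<lambda>\<omega>. halfwidth (Y \<omega>)) \<in> borel_measurable N"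
  unfolding halfwidth_def
  by (rule measurable_compose_countable[where f = "\<lambda>j _. (1 + Cb) * noise \<nu> j", OF _ level_measurable]) simp

lemma center_measurable: "(\<lambda>\<omega>. estimator D \<eta> (level (Y \<omega>)) (Y \<omega>) x) \<in> borel_measurable N"
  by (rule measurable_compose_countable[OF estimator_path_measurable level_measurable]) (rule Y)

lemma center_error_measurable:
  "(\<lambda>\<omega>. SUP x\<in>{0..1}. ereal \<bar>estimator D \<eta> (level (Y \<omega>)) (Y \<omega>) x - f x\<bar>) \<in> borel_measurable N"
proof (rule measurable_compose_countable[OF _ level_measurable])
  show "(\<lambda>\<omega>. SUP x\<in>{0..1}. ereal \<bar>estimator D \<eta> j (Y \<omega>) x - f x\<bar>) \<in> borel_measurable N" for j
    unfolding estimator_def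
    by (rule borel_measurable_SUP_linear_combination) (auto simp: obs_grid_def intro: Y)
qed

end

context
  assumes \<nu>: "\<nu> \<ge> 0" and Cb: "Cb \<ge> 0"
begin

lemma halfwidth_nonneg: "halfwidth y \<ge> 0"
  using \<nu> Cb by (simp add: halfwidth_def noise_nonneg)

lemma confidence_band_band: "confidence_band \<eta> band"
proof -
  note meas = halfwidth_measurable[OF path_space_measurable] center_measurable[OF path_space_measurable]
  show ?thesis
    unfolding confidence_band_def band_def Sup_Inf_ereal_Icc[OF halfwidth_nonneg]
    using meas by (auto intro!: is_interval_cc borel_measurable_ereal borel_measurable_add borel_measurable_diff)
qed

text \<open>All intervals of the band have the same length and are centred at the estimator, so both
  uncountable conditions reduce to two random variables.\<close>

lemma narrow_cover_event_band:
  "narrow_cover_event M band Y r f = {\<omega> \<in> space M. 2 * halfwidth (Y \<omega>) \<le> r \<and>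
     (SUP x\<in>{0..1}. ereal \<bar>estimator D \<eta> (level (Y \<omega>)) (Y \<omega>) x - f x\<bar>) \<le> ereal (halfwidth (Y \<omega>))}"
proof -
  have "(SUP x\<in>{0..1::real}. interval_length (band x y)) = ereal (2 * halfwidth y)" for y
    by (simp add: band_def interval_length_Icc halfwidth_nonneg)
  moreover have "(\<forall>x\<in>{0..1}. f x \<in> band x y) \<longleftrightarrow>
     (SUP x\<in>{0..1}. ereal \<bar>estimator D \<eta> (level y) y x - f x\<bar>) \<le> ereal (halfwidth y)" for y
    by (auto simp: SUP_le_iff band_def abs_le_iff)
  ultimately show ?thesis by (simp add: narrow_cover_event_def)
qed

lemma narrow_cover_event_measurable:
  assumes "\<And>p. - \<eta> \<le> p \<Longrightarrow> p \<le> 1 + \<eta> \<Longrightarrow> (\<lambda>\<omega>. Y \<omega> p) \<in> borel_measurable M"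
  shows "narrow_cover_event M band Y r f \<in> sets M"
proof -
  note [measurable] = halfwidth_measurable[of Y M, OF assms] center_error_measurable[of Y M, OF assms]
  show ?thesis unfolding narrow_cover_event_band by measurable
qed

section \<open>Deterministic analysis on paths for which the estimators are close to
  \<open>f\<close>\<close>

context
  fixes f y :: "real \<Rightarrow> real" and j0 \<gamma> \<gamma>low B Ct :: real
  assumes f: "f \<in> self_similar_class K j0 \<gamma> B \<epsilon>" and j0: "j0 \<le> real jmin"
    and \<gamma>: "0 < \<gamma>low" "\<gamma>low \<le> \<gamma>" and B: "0 < B"
    and upper: "\<And>k. approx_error K (int k) f \<le> ereal (Ct * B * 2 powr (- (real k * \<gamma>)))"
    and lag: "(1 + L1_bound) * Cb * 2 powr (- (real lag * \<gamma>low)) \<le> \<epsilon> / 2"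
    and close: "\<And>j x. jmin \<le> j \<Longrightarrow> j \<le> jmax + lag \<Longrightarrow>
      - (CK / 2 ^ jmin) \<le> x \<Longrightarrow> x \<le> 1 + CK / 2 ^ jmin \<Longrightarrow>
      \<bar>estimator D \<eta> j y x - f x\<bar> \<le> Cb * B * 2 powr (- (real j * \<gamma>)) + noise \<nu> j"
begin

text \<open>The kernel errors of the estimator and of \<open>f\<close> differ by at most
  \<open>\<kappa> * e\<close>. The bias in \<open>e\<close> is smaller by a factor depending on
  \<open>lag\<close> than the signal at level \<open>k\<close>, and the noise in \<open>e\<close> is
  what \<open>smoothed_error\<close> adds.\<close>

lemma smoothed_error_bounds:
  assumes k: "jmin \<le> k" "k \<le> jmax"
  shows "\<epsilon> * B * 2 powr (- (real k * \<gamma>)) \<le> smoothed_error k y"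
    and "smoothed_error k y \<le> 2 * (Ct + (1 + L1_bound) * Cb) * B * 2 powr (- (real k * \<gamma>))
      + 4 * (1 + L1_bound) * noise \<nu> (k + lag)"
proof -
  define \<kappa> where "\<kappa> = 1 + L1_bound"
  define p where "p = (2::real) powr (- (real k * \<gamma>))"
  define N where "N = noise \<nu> (k + lag)"
  define e where "e = Cb * B * 2 powr (- (real (k + lag) * \<gamma>)) + N"
  define g where "g = estimator D \<eta> (k + lag) y"
  have \<kappa>: "\<kappa> > 0" using L1_bound_pos by (simp add: \<kappa>_def)
  have p: "p > 0" by (simp add: p_def)
  have hol: "f \<in> holder_class \<gamma> B"
    and lower: "ereal (\<epsilon> * B * p) \<le> approx_error K (int k) f"
    using f j0 k by (auto simp: self_similar_class_def p_def dest!: spec[of _ "int k"])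
  have cont: "continuous_on UNIV f"
    using \<gamma> by (intro holder_class_continuous_on[OF hol]) auto
  have g: "g \<in> borel_measurable borel" by (simp add: g_def)
  have CKk: "CK / 2 ^ k \<le> CK / 2 ^ jmin"
    using CK k by (intro divide_left_mono power_increasing) auto
  have e: "\<bar>g x - f x\<bar> \<le> e" if "- (CK / 2 ^ k) \<le> x" "x \<le> 1 + CK / 2 ^ k" for x
    unfolding g_def e_def N_def using that CKk k by (intro close) auto
  have diff: "approx_error K (int k) g \<le> approx_error K (int k) f + ereal (\<kappa> * e)"
    "approx_error K (int k) f \<le> approx_error K (int k) g + ereal (\<kappa> * e)"
    unfolding \<kappa>_def by (intro approx_error_diff_le[OF cont g] e; assumption)+
  have nonneg: "0 \<le> approx_error K (int k) h" for h
    unfolding approx_error_def by (rule SUP_upper2[of 0]) auto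
  \<comment> \<open>Both suprema are finite, so the default value of \<open>real_of_ereal\<close> at
    infinity does not enter.\<close>
  obtain \<delta> where \<delta>: "approx_error K (int k) f = ereal \<delta>"
    using upper[of k] nonneg[of f] by (cases "approx_error K (int k) f") auto
  obtain d where d: "approx_error K (int k) g = ereal d"
    using diff(1) nonneg[of g] unfolding \<delta> by (cases "approx_error K (int k) g") auto
  have E: "smoothed_error k y = 2 * (d + \<kappa> * N)"
    using d by (simp add: smoothed_error_def g_def \<kappa>_def N_def)
  have "\<delta> \<le> Ct * B * p" using upper[of k] by (simp add: \<delta> p_def)
  have "\<epsilon> * B * p \<le> \<delta>" using lower by (simp add: \<delta>)
  have "d \<le> \<delta> + \<kappa> * e" "\<delta> \<le> d + \<kappa> * e" using diff by (simp_all add: d \<delta>)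
  have p_lag: "2 powr (- (real (k + lag) * \<gamma>)) = p * 2 powr (- (real lag * \<gamma>))"
    by (simp add: p_def powr_add[symmetric] algebra_simps)
  \<comment> \<open>\<open>lag\<close> can be chosen knowing only the smallest smoothness in the
    range.\<close>
  have "2 powr (- (real lag * \<gamma>)) \<le> (2::real) powr (- (real lag * \<gamma>low))"
    using \<gamma> by (intro powr_mono) (auto intro: mult_left_mono)
  then have "\<kappa> * Cb * 2 powr (- (real lag * \<gamma>)) \<le> \<kappa> * Cb * 2 powr (- (real lag * \<gamma>low))"
    using \<kappa> Cb by (intro mult_left_mono) auto
  also have "\<dots> \<le> \<epsilon> / 2" using lag by (simp add: \<kappa>_def)
  finally have "\<kappa> * Cb * 2 powr (- (real lag * \<gamma>)) * (B * p) \<le> \<epsilon> / 2 * (B * p)"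
    using B p by (intro mult_right_mono) auto
  then have small: "\<kappa> * e \<le> \<epsilon> / 2 * (B * p) + \<kappa> * N"
    unfolding e_def p_lag by (simp add: algebra_simps)
  \<comment> \<open>For the upper bound the lag is deliberately wasted: the resulting constant
    depends neither on \<open>lag\<close> nor on \<epsilon>.\<close>
  have "2 powr (- (real lag * \<gamma>)) \<le> (2::real) powr 0"
    using \<gamma> by (intro powr_mono) auto
  then have "\<kappa> * Cb * (B * p) * 2 powr (- (real lag * \<gamma>)) \<le> \<kappa> * Cb * (B * p) * 1"
    using \<kappa> Cb B p by (intro mult_left_mono) auto
  then have large: "\<kappa> * e \<le> \<kappa> * Cb * (B * p) + \<kappa> * N"
    unfolding e_def p_lag by (simp add: algebra_simps)
  have "\<epsilon> * B * p \<le> 2 * (d + \<kappa> * N)"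
    using \<open>\<epsilon> * B * p \<le> \<delta>\<close> \<open>\<delta> \<le> d + \<kappa> * e\<close> small by (simp add: algebra_simps)
  then show "\<epsilon> * B * 2 powr (- (real k * \<gamma>)) \<le> smoothed_error k y"
    by (simp add: E p_def)
  have "d \<le> Ct * B * p + (\<kappa> * Cb * (B * p) + \<kappa> * N)"
    by (rule order_trans[OF \<open>d \<le> \<delta> + \<kappa> * e\<close>]) (rule add_mono[OF \<open>\<delta> \<le> Ct * B * p\<close> large])
  then show "smoothed_error k y \<le> 2 * (Ct + (1 + L1_bound) * Cb) * B * 2 powr (- (real k * \<gamma>))
      + 4 * (1 + L1_bound) * noise \<nu> (k + lag)"
    unfolding E p_def[symmetric] N_def[symmetric] \<kappa>_def[symmetric] by (simp add: algebra_simps)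
qed

text \<open>The level found by \<open>bias_bound_resolved\<close> meets the selection criterion, so
  the selected level is no later and its noise no larger. At the selected level the criterion forces
  the bias below the noise, which gives coverage.\<close>

lemma band_covers:
  fixes C\<^sub>1 :: real
  assumes C\<^sub>1: "2 * (Ct + (1 + L1_bound) * Cb + 1) \<le> C\<^sub>1" "0 < C\<^sub>1"
    and pos: "0 < \<epsilon>" "0 < Blow" "0 < \<nu>" "0 < jmin"
    and B': "Blow \<le> B" "B \<le> Bup" and \<gamma>up: "\<gamma> \<le> \<gamma>up"
    and g: "4 * (1 + L1_bound) * C\<^sub>1 / \<epsilon> * 2 powr ((real lag + 1 - real g) / 2) \<le> 1" "0 < g"
    and m0: "jmin + g \<le> m0" "m0 \<le> jmax"
      "max 1 (C\<^sub>1 * Bup / (\<epsilon> * Blow)) powr (real g / (real m0 - real g)) \<le> 2"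
      "noise \<nu> m0 < 2 * C\<^sub>1 * Blow / \<epsilon> * 2 powr (- (real m0 * \<gamma>up))"
    and jmax: "2 * C\<^sub>1 * Bup / \<epsilon> \<le> noise \<nu> jmax"
  shows "halfwidth y \<le> (1 + Cb) * (sqrt 2 * ((2 * C\<^sub>1 * B / \<epsilon>) powr (1 / (2 * \<gamma> + 1))
      * \<nu> powr (2 * \<gamma> / (2 * \<gamma> + 1))))"
    and "(SUP x\<in>{0..1}. ereal \<bar>estimator D \<eta> (level y) y x - f x\<bar>) \<le> ereal (halfwidth y)"
proof -
  \<comment> \<open>Where the bias dominates the lagged noise, the noise terms are absorbed; this is
    the summand 1 in the bound for \<open>C\<^sub>1\<close>.\<close>
  have E_le: "smoothed_error k y \<le> C\<^sub>1 * B * 2 powr (- (real k * \<gamma>))"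
    if k: "jmin \<le> k" "k \<le> jmax" and N: "2 * (1 + L1_bound) * noise \<nu> (k + lag) \<le> B * 2 powr (- (real k * \<gamma>))" for k
  proof -
    have "smoothed_error k y \<le> 2 * (Ct + (1 + L1_bound) * Cb) * B * 2 powr (- (real k * \<gamma>))
        + 2 * (2 * (1 + L1_bound) * noise \<nu> (k + lag))"
    proof -
      have "4 * (1 + L1_bound) * noise \<nu> (k + lag) = 2 * (2 * (1 + L1_bound) * noise \<nu> (k + lag))"
        by (simp add: algebra_simps)
      with smoothed_error_bounds(2)[OF k] show ?thesis by linarith
    qed
    also have "\<dots> \<le> 2 * (Ct + (1 + L1_bound) * Cb) * B * 2 powr (- (real k * \<gamma>))
        + 2 * (B * 2 powr (- (real k * \<gamma>)))"
      using N by linarith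
    also have "\<dots> = 2 * (Ct + (1 + L1_bound) * Cb + 1) * (B * 2 powr (- (real k * \<gamma>)))"
      by (simp add: algebra_simps)
    also have "\<dots> \<le> C\<^sub>1 * (B * 2 powr (- (real k * \<gamma>)))"
      using C\<^sub>1 B by (intro mult_right_mono) auto
    finally show ?thesis by simp
  qed
  have E_nonneg: "0 \<le> smoothed_error k y" if "jmin \<le> k" "k \<le> jmax" for k
    by (rule order_trans[OF _ smoothed_error_bounds(1)[OF that]]) (use pos B in simp)
  let ?P = "\<lambda>j. \<exists>k\<in>{jmin..j}. bias_bound \<epsilon> Blow k j (smoothed_error k y) \<le> noise \<nu> j"
  obtain j where j: "jmin \<le> j" "j \<le> jmax" "?P j" and rate: "noise \<nu> j
      \<le> sqrt 2 * ((2 * C\<^sub>1 * B / \<epsilon>) powr (1 / (2 * \<gamma> + 1)) * \<nu> powr (2 * \<gamma> / (2 * \<gamma> + 1)))"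
    using bias_bound_resolved[where E = "\<lambda>k. smoothed_error k y" and lag = lag and \<kappa> = "1 + L1_bound"
        and jmin = jmin and jmax = jmax, OF pos(1,2) C\<^sub>1(2) _ pos(3,4) B' _ \<gamma>up E_nonneg E_le g m0 jmax]
      \<gamma> L1_bound_pos by auto
  note level = select_level_le[where P = ?P, OF j(3,1,2), folded level_def]
  show "halfwidth y \<le> (1 + Cb) * (sqrt 2 * ((2 * C\<^sub>1 * B / \<epsilon>) powr (1 / (2 * \<gamma> + 1))
      * \<nu> powr (2 * \<gamma> / (2 * \<gamma> + 1))))"
    unfolding halfwidth_def using Cb noise_mono[OF \<nu> level(1)] rate by (intro mult_left_mono) auto
  obtain k where k: "jmin \<le> k" "k \<le> level y"
    "bias_bound \<epsilon> Blow k (level y) (smoothed_error k y) \<le> noise \<nu> (level y)"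
    using level(2) by auto
  \<comment> \<open>Valid for whichever \<open>k\<close> triggered the selection, so coverage does
    not depend on the signal being well resolved at that \<open>k\<close>.\<close>
  have "B * 2 powr (- (real (level y) * \<gamma>)) \<le> bias_bound \<epsilon> Blow k (level y) (smoothed_error k y)"
    using pos B' k level(1) j by (intro bias_bound_ge smoothed_error_bounds(1)) auto
  then have bias: "B * 2 powr (- (real (level y) * \<gamma>)) \<le> noise \<nu> (level y)"
    using k(3) by linarith
  have "0 \<le> CK / 2 ^ jmin" using CK by simp
  then have "\<bar>estimator D \<eta> (level y) y x - f x\<bar> \<le> halfwidth y" if "x \<in> {0..1}" for x
  proof -
    have "\<bar>estimator D \<eta> (level y) y x - f x\<bar>
        \<le> Cb * B * 2 powr (- (real (level y) * \<gamma>)) + noise \<nu> (level y)"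
      using \<open>0 \<le> CK / 2 ^ jmin\<close> that level j by (intro close) auto
    also have "\<dots> \<le> halfwidth y"
      using mult_left_mono[OF bias Cb] by (simp add: halfwidth_def algebra_simps)
    finally show ?thesis .
  qed
  then show "(SUP x\<in>{0..1}. ereal \<bar>estimator D \<eta> (level y) y x - f x\<bar>) \<le> ereal (halfwidth y)"
    by (intro SUP_least) auto
qed

end

end

end


section \<open>Increments of Brownian motion on dyadic grids\<close>

text \<open>The right end of an increment may lie just outside the observation window. This event
  serves the analysis only and is not computed from the data.\<close>

definition small_increments :: "'a measure \<Rightarrow> (real \<Rightarrow> 'a \<Rightarrow> real) \<Rightarrow> real \<Rightarrow> real \<Rightarrow> nat \<Rightarrow> 'a set" where
  "small_increments M W \<eta> q J = {\<omega> \<in> space M. \<forall>j\<le>J. \<forall>i\<in>obs_grid \<eta> j.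
     \<bar>W (of_int (i + 1) / 2 ^ j) \<omega> - W (of_int i / 2 ^ j) \<omega>\<bar> \<le> q * 2 powr (- (real j / 2))}"

text \<open>Union bound: each normalised increment exceeds \<open>q\<close> with probability at most
  \<open>sqrt 2 * exp (- (q^2 / 4))\<close>, level \<open>j\<close> has at most a constant times
  \<open>2 ^ j\<close> of them, and these counts sum geometrically.\<close>

lemma small_increments_prob:
  assumes W: "two_sided_brownian_motion M W" and "\<eta> > 0" "q \<ge> 0"
  shows "small_increments M W \<eta> q J \<in> sets M"
    and "1 - (2 + 2 * \<eta>) * sqrt 2 * exp (- (q\<^sup>2 / 4)) * 2 ^ Suc J \<le> measure M (small_increments M W \<eta> q J)"
proof -
  interpret prob_space M using W by (simp add: two_sided_brownian_motion_def)
  have [measurable]: "W t \<in> borel_measurable M" for t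
    using W by (simp add: two_sided_brownian_motion_def)
  define bad where "bad j i = {\<omega> \<in> space M. q * 2 powr (- (real j / 2)) <
     \<bar>W (of_int (i + 1) / 2 ^ j) \<omega> - W (of_int i / 2 ^ j) \<omega>\<bar>}" for j i
  define c where "c = sqrt 2 * exp (- (q\<^sup>2 / 4))"
  have bad_sets: "bad j i \<in> sets M" for j i unfolding bad_def by measurable
  have bad_prob: "prob (bad j i) \<le> c" for j i
  proof -
    let ?s = "of_int i / 2 ^ j :: real" and ?t = "of_int (i + 1) / 2 ^ j :: real"
    have st: "?s < ?t" by (simp add: divide_strict_right_mono)
    have diff: "?t - ?s = 1 / 2 ^ j" by (simp add: add_divide_distrib)
    have D: "distributed M lborel (\<lambda>\<omega>. W ?t \<omega> - W ?s \<omega>) (normal_density 0 (sqrt (1 / 2 ^ j)))"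
      using W st unfolding two_sided_brownian_motion_def by (metis diff)
    have sq: "(2 powr (- (real j / 2)))\<^sup>2 = 1 / (2::real) ^ j"
      by (simp add: power2_eq_square powr_add[symmetric] powr_minus_divide powr_realpow)
    have "(q * 2 powr (- (real j / 2)))\<^sup>2 / (4 * (sqrt (1 / 2 ^ j))\<^sup>2) = q\<^sup>2 / 4"
      unfolding power_mult_distrib sq by (simp add: field_simps)
    then show ?thesis
      using normal_abs_tail[OF D, of "q * 2 powr (- (real j / 2))"] \<open>q \<ge> 0\<close>
      by (simp add: bad_def c_def)
  qed
  have eq: "small_increments M W \<eta> q J = space M - (\<Union>j\<in>{..J}. \<Union>i\<in>obs_grid \<eta> j. bad j i)"
    by (auto simp: small_increments_def bad_def not_less) (meson not_le)
  have bad_UN: "(\<Union>j\<in>{..J}. \<Union>i\<in>obs_grid \<eta> j. bad j i) \<in> sets M"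
    using bad_sets by (intro sets.finite_UN) auto
  then show "small_increments M W \<eta> q J \<in> sets M" unfolding eq by auto
  have "prob (\<Union>j\<in>{..J}. \<Union>i\<in>obs_grid \<eta> j. bad j i) \<le> (\<Sum>j\<le>J. prob (\<Union>i\<in>obs_grid \<eta> j. bad j i))"
    using bad_sets by (intro finite_measure_subadditive_finite) (auto intro!: sets.finite_UN)
  also have "\<dots> \<le> (\<Sum>j\<le>J. (2 + 2 * \<eta>) * c * 2 ^ j)"
  proof (rule sum_mono)
    fix j
    have "prob (\<Union>i\<in>obs_grid \<eta> j. bad j i) \<le> (\<Sum>i\<in>obs_grid \<eta> j. prob (bad j i))"
      using bad_sets by (intro finite_measure_subadditive_finite) auto
    also have "\<dots> \<le> (\<Sum>i\<in>obs_grid \<eta> j. c)" by (intro sum_mono bad_prob)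
    also have "\<dots> = real (card (obs_grid \<eta> j)) * c" by simp
    also have "\<dots> \<le> (2 + 2 * \<eta>) * 2 ^ j * c"
      using card_obs_grid_le[OF \<open>\<eta> > 0\<close>] by (intro mult_right_mono) (auto simp: c_def)
    finally show "prob (\<Union>i\<in>obs_grid \<eta> j. bad j i) \<le> (2 + 2 * \<eta>) * c * 2 ^ j"
      by (simp add: mult_ac)
  qed
  also have "\<dots> = (2 + 2 * \<eta>) * c * (\<Sum>j\<le>J. 2 ^ j)" by (simp add: sum_distrib_left)
  also have "(\<Sum>j\<le>J. 2 ^ j) \<le> (2::real) ^ Suc J"
    using sum_gp_basic[of "2::real" J] by simp
  then have "(2 + 2 * \<eta>) * c * (\<Sum>j\<le>J. 2 ^ j) \<le> (2 + 2 * \<eta>) * c * 2 ^ Suc J"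
    using \<open>\<eta> > 0\<close> by (intro mult_left_mono) (auto simp: c_def)
  finally have "prob (\<Union>j\<in>{..J}. \<Union>i\<in>obs_grid \<eta> j. bad j i) \<le> (2 + 2 * \<eta>) * c * 2 ^ Suc J" .
  then show "1 - (2 + 2 * \<eta>) * sqrt 2 * exp (- (q\<^sup>2 / 4)) * 2 ^ Suc J \<le> prob (small_increments M W \<eta> q J)"
    unfolding eq using prob_compl[OF bad_UN] by (simp add: c_def mult.assoc)
qed


section \<open>Tuning sequences\<close>

text \<open>With the constant 8 the tail \<open>exp (- (q^2 / 4))\<close> is the fourth power of a
  small \<open>s\<close>, which beats the number of increments. The maximum with 0 covers noise
  levels above one.\<close>

definition log_factor :: "real \<Rightarrow> real" where
  "log_factor s = sqrt (8 * max 0 (ln (1 / s\<^sup>2)))"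

text \<open>Fine enough for the noise with the logarithmic factor to diverge at this level, yet
  \<open>2 ^ max_level s\<close> is at most the inverse square of a small \<open>s\<close>, as the
  union bound needs.\<close>

definition max_level :: "real \<Rightarrow> nat" where
  "max_level s = nat \<lfloor>log 2 (1 / s\<^sup>2)\<rfloor>"

lemma max_level_bounds:
  assumes "0 < s" "s \<le> 1"
  shows "2 ^ max_level s \<le> 1 / s\<^sup>2" "1 / s\<^sup>2 \<le> 2 * 2 ^ max_level s"
proof -
  have "1 \<le> 1 / s\<^sup>2" using assms by (simp add: power_le_one)
  then have "log 2 1 \<le> log 2 (1 / s\<^sup>2)" by (intro log_mono) auto
  then have "0 \<le> log 2 (1 / s\<^sup>2)" by (simp only: log_one)
  then have m: "real (max_level s) \<le> log 2 (1 / s\<^sup>2)" "log 2 (1 / s\<^sup>2) \<le> real (max_level s) + 1"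
    unfolding max_level_def by linarith+
  have eq: "2 powr log 2 (1 / s\<^sup>2) = 1 / s\<^sup>2" using assms by (intro powr_log_cancel) auto
  show "2 ^ max_level s \<le> 1 / s\<^sup>2"
    using powr_mono[OF m(1), of 2] unfolding eq by (simp add: powr_realpow)
  show "1 / s\<^sup>2 \<le> 2 * 2 ^ max_level s"
    using powr_mono[OF m(2), of 2] unfolding eq by (simp add: powr_realpow powr_add)
qed

text \<open>The rate is the power of \<open>s * sqrt (ln (1 / s^2))\<close> that appears on the
  left. Constants raised to exponents between 0 and 1 are replaced by their maximum with 1, so that
  no \<gamma> remains in the factor.\<close>

lemma log_factor_noise_rate:
  assumes "0 < s" "s \<le> 1" "0 < c" "0 < \<gamma>" "0 < a" "0 < B" "0 < \<epsilon>"
  shows "(a * B / \<epsilon>) powr (1 / (2 * \<gamma> + 1)) * (c * log_factor s * s) powr (2 * \<gamma> / (2 * \<gamma> + 1))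
    \<le> max 1 a * max 1 (c * sqrt 8) * band_rate s \<gamma> B \<epsilon>"
proof -
  let ?p = "1 / (2 * \<gamma> + 1)" and ?r = "2 * \<gamma> / (2 * \<gamma> + 1)"
  define l where "l = ln (1 / s\<^sup>2)"
  have "1 \<le> 1 / s\<^sup>2" using assms by (simp add: power_le_one)
  then have l: "l \<ge> 0" by (simp add: l_def)
  have x_le: "x powr t \<le> max 1 x" if "0 < x" "0 \<le> t" "t \<le> 1" for x t :: real
  proof -
    have "x powr t \<le> max 1 x powr t" using that by (intro powr_mono2) auto
    also have "\<dots> \<le> max 1 x powr 1" using that by (intro powr_mono) auto
    finally show ?thesis by simp
  qed
  have p: "0 \<le> ?p" "?p \<le> 1" "0 \<le> ?r" "?r \<le> 1" using \<open>0 < \<gamma>\<close> by (simp_all add: field_simps)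
  have "(c * log_factor s * s) = (c * sqrt 8) * sqrt (s\<^sup>2 * l)"
    using assms l by (simp add: log_factor_def l_def real_sqrt_mult max_def)
  moreover have "sqrt (s\<^sup>2 * l) powr ?r = (s\<^sup>2 * l) powr (\<gamma> / (2 * \<gamma> + 1))"
    using l by (simp add: powr_half_sqrt[symmetric] powr_powr)
  moreover have "(a * B / \<epsilon>) powr ?p = a powr ?p * (B / \<epsilon>) powr ?p"
    using assms powr_mult[of a "B / \<epsilon>" ?p] by simp
  moreover have "((c * sqrt 8) * sqrt (s\<^sup>2 * l)) powr ?r = (c * sqrt 8) powr ?r * sqrt (s\<^sup>2 * l) powr ?r"
    by (rule powr_mult)
  ultimately have "(a * B / \<epsilon>) powr ?p * (c * log_factor s * s) powr ?r
      = (a powr ?p * (B / \<epsilon>) powr ?p) * ((c * sqrt 8) powr ?r * (s\<^sup>2 * l) powr (\<gamma> / (2 * \<gamma> + 1)))"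
    by (simp only:)
  also have "\<dots> = a powr ?p * (c * sqrt 8) powr ?r * band_rate s \<gamma> B \<epsilon>"
    unfolding band_rate_def l_def by (simp only: mult_ac)
  also have "\<dots> \<le> max 1 a * max 1 (c * sqrt 8) * band_rate s \<gamma> B \<epsilon>"
    using assms p by (intro mult_right_mono mult_mono x_le) (auto simp: band_rate_def)
  finally show ?thesis .
qed

lemma noise_level_limits:
  assumes "0 < \<sigma>" "0 < c"
  defines "s \<equiv> noise_level \<sigma>"
  shows "s \<longlonglongrightarrow> 0"
    and "(\<lambda>n. c * log_factor (s n) * s n) \<longlonglongrightarrow> 0"
    and "filterlim (\<lambda>n. noise (c * log_factor (s n) * s n) (max_level (s n))) at_top sequentially"
    and "filterlim (\<lambda>n. max_level (s n)) at_top sequentially"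
proof -
  have pos: "\<forall>\<^sub>F n in sequentially. 0 < s n"
    using eventually_gt_at_top[of 0] by eventually_elim (simp add: s_def noise_level_def \<open>0 < \<sigma>\<close>)
  show s0: "s \<longlonglongrightarrow> 0"
    unfolding s_def noise_level_def using \<open>0 < \<sigma>\<close> by real_asymp
  have le1: "\<forall>\<^sub>F n in sequentially. s n \<le> 1"
    using order_tendstoD(2)[OF s0, of 1] by (auto elim: eventually_mono)
  have at0: "filterlim s (at_right 0) sequentially"
    using s0 pos by (auto simp: filterlim_at eventually_mono)
  have "((\<lambda>x. c * log_factor x * x) \<longlongrightarrow> 0) (at_right 0)"
  proof (rule Lim_transform_eventually)
    show "((\<lambda>x::real. c * sqrt (8 * ln (1 / x\<^sup>2)) * x) \<longlongrightarrow> 0) (at_right 0)"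
      by real_asymp
    have "\<forall>\<^sub>F x in at_right (0::real). 0 < x \<and> x < 1"
      using eventually_at_right_real[of 0 1] by simp
    then show "\<forall>\<^sub>F x in at_right 0. c * sqrt (8 * ln (1 / x\<^sup>2)) * x = c * log_factor x * x"
    proof eventually_elim
      case (elim x)
      then have "1 \<le> 1 / x\<^sup>2" by (simp add: power_le_one)
      then have "0 \<le> ln (1 / x\<^sup>2)" by simp
      then show ?case by (simp add: log_factor_def)
    qed
  qed
  then show "(\<lambda>n. c * log_factor (s n) * s n) \<longlonglongrightarrow> 0"
    by (rule filterlim_compose) (rule at0)
  have lf: "filterlim log_factor at_top (at_right 0)"
  proof (rule filterlim_at_top_mono)
    show "filterlim (\<lambda>x::real. sqrt (8 * ln (1 / x\<^sup>2))) at_top (at_right 0)" by real_asymp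
    show "\<forall>\<^sub>F x in at_right 0. sqrt (8 * ln (1 / x\<^sup>2)) \<le> log_factor x"
      by (simp add: log_factor_def)
  qed
  \<comment> \<open>This minorises the noise at the maximal level; the \<open>sqrt 2\<close> pays
    for the rounding in \<open>max_level\<close>.\<close>
  have "filterlim (\<lambda>n. c / sqrt 2 * log_factor (s n)) at_top sequentially"
    using \<open>0 < c\<close> by (intro filterlim_tendsto_pos_mult_at_top[OF tendsto_const]
        filterlim_compose[OF lf at0]) auto
  then show "filterlim (\<lambda>n. noise (c * log_factor (s n) * s n) (max_level (s n))) at_top sequentially"
  proof (rule filterlim_at_top_mono)
    show "\<forall>\<^sub>F n in sequentially. c / sqrt 2 * log_factor (s n)
        \<le> noise (c * log_factor (s n) * s n) (max_level (s n))"
      using pos le1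
    proof eventually_elim
      case (elim n)
      have "1 / (s n)\<^sup>2 \<le> 2 * 2 ^ max_level (s n)"
        using elim by (intro max_level_bounds) auto
      then have "sqrt (1 / (s n)\<^sup>2) \<le> sqrt (2 * 2 ^ max_level (s n))"
        by (rule real_sqrt_le_mono)
      then have "1 / s n \<le> sqrt 2 * sqrt (2 ^ max_level (s n))"
        using elim by (simp add: real_sqrt_divide real_sqrt_mult)
      also have "sqrt (2 ^ max_level (s n)) = 2 powr (real (max_level (s n)) / 2)"
        by (simp add: powr_half_sqrt[symmetric] powr_realpow[symmetric] powr_powr)
      finally have "1 / sqrt 2 \<le> s n * 2 powr (real (max_level (s n)) / 2)"
        using elim by (simp add: field_simps)
      then have "c * log_factor (s n) * (1 / sqrt 2)
          \<le> c * log_factor (s n) * (s n * 2 powr (real (max_level (s n)) / 2))"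
        using \<open>0 < c\<close> by (intro mult_left_mono) (auto simp: log_factor_def)
      then show ?case by (simp add: noise_def mult.assoc)
    qed
  qed
  have "filterlim (\<lambda>x::real. log 2 (1 / x\<^sup>2)) at_top (at_right 0)" by real_asymp
  then have "filterlim (\<lambda>n. log 2 (1 / (s n)\<^sup>2)) at_top sequentially"
    by (rule filterlim_compose) (rule at0)
  then have "filterlim (\<lambda>n. nat \<lfloor>log 2 (1 / (s n)\<^sup>2)\<rfloor>) at_top sequentially"
    by (intro filterlim_compose[OF filterlim_nat_sequentially] filterlim_compose[OF filterlim_floor_sequentially])
  then show "filterlim (\<lambda>n. max_level (s n)) at_top sequentially"
    by (simp add: max_level_def)
qed


section \<open>Probability that the band is narrow and covers\<close>

context adaptive_band
begin

text \<open>On the event \<open>G\<close> of small increments, \<open>estimator_error\<close>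
  supplies the closeness that \<open>band_covers\<close> needs. The failure bound is free of
  \<gamma>, \<open>B\<close> and \<open>f\<close>, hence uniform over the class.\<close>

lemma narrow_cover_event_prob:
  fixes f :: "real \<Rightarrow> real" and A Bup Ct C\<^sub>1 j0 s \<gamma> \<gamma>low \<gamma>up :: real
  assumes W: "two_sided_brownian_motion M W" and "\<eta> > 0" and s: "0 < s" "s < 1"
    and D: "D = strict_floor \<gamma>up + 1"
    and A: "A > 0" "\<And>i u. \<bar>diff_weight D i u\<bar> \<le> A"
    and Cb: "Cb = (real D + 1) * A * real D powr (\<gamma>up + 1)"
    and \<nu>: "\<nu> = (real D + 1) * A * real D * log_factor s * s"
    and jmax: "jmax = max_level s" "2 * C\<^sub>1 * Bup / \<epsilon> \<le> noise \<nu> jmax"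
    and window: "(CK + real D) / 2 ^ jmin \<le> \<eta>"
    and f: "f \<in> self_similar_class K j0 \<gamma> B \<epsilon>" and jmin: "j0 \<le> real jmin" "0 < jmin"
    and \<gamma>: "0 < \<gamma>low" "\<gamma>low \<le> \<gamma>" "\<gamma> \<le> \<gamma>up"
    and B: "0 < Blow" "Blow \<le> B" "B \<le> Bup" and "0 < \<epsilon>"
    and upper: "\<And>k. approx_error K (int k) f \<le> ereal (Ct * B * 2 powr (- (real k * \<gamma>)))"
    and lag: "(1 + L1_bound) * Cb * 2 powr (- (real lag * \<gamma>low)) \<le> \<epsilon> / 2"
    and C\<^sub>1: "2 * (Ct + (1 + L1_bound) * Cb + 1) \<le> C\<^sub>1" "0 < C\<^sub>1"
    and g: "4 * (1 + L1_bound) * C\<^sub>1 / \<epsilon> * 2 powr ((real lag + 1 - real g) / 2) \<le> 1" "0 < g"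
    and m0: "jmin + g \<le> m0" "m0 \<le> jmax"
      "max 1 (C\<^sub>1 * Bup / (\<epsilon> * Blow)) powr (real g / (real m0 - real g)) \<le> 2"
      "noise \<nu> m0 < 2 * C\<^sub>1 * Blow / \<epsilon> * 2 powr (- (real m0 * \<gamma>up))"
  shows "1 - (2 + 2 * \<eta>) * sqrt 2 * 2 ^ Suc lag * s\<^sup>2
    \<le> measure M (narrow_cover_event M band (white_noise_data \<eta> s f W)
        (2 * (1 + Cb) * sqrt 2 * (max 1 (2 * C\<^sub>1) * max 1 ((real D + 1) * A * real D * sqrt 8))
          * band_rate s \<gamma> B \<epsilon>) f)"
proof -
  interpret prob_space M using W by (simp add: two_sided_brownian_motion_def)
  let ?Y = "white_noise_data \<eta> s f W"
  let ?c = "(real D + 1) * A * real D"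
  let ?r = "2 * (1 + Cb) * sqrt 2 * (max 1 (2 * C\<^sub>1) * max 1 (?c * sqrt 8)) * band_rate s \<gamma> B \<epsilon>"
  define q where "q = log_factor s"
  define F where "F t = (LBINT u=ereal 0..ereal t. f u)" for t
  define l where "l = ln (1 / s\<^sup>2)"
  have "0 < s\<^sup>2" "s\<^sup>2 < 1" using s by (auto simp: power_less_one_iff)
  then have l: "l > 0" unfolding l_def by (intro ln_gt_zero) (simp add: field_simps)
  have q: "q > 0" "q\<^sup>2 = 8 * l"
    using l by (simp_all add: q_def log_factor_def l_def)
  have pos: "0 < \<gamma>" "0 < B" "0 \<le> Cb" "0 < ?c" "0 < \<nu>"
    using \<gamma> B A(1) D s q by (simp_all add: Cb \<nu> q_def)
  have hol: "f \<in> holder_class \<gamma> B" using f by (simp add: self_similar_class_def)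
  have F: "(F has_real_derivative f t) (at t)" for t
    unfolding F_def using pos
    by (intro continuous_primitive_has_real_derivative holder_class_continuous_on[OF hol])
  have W_meas: "W t \<in> borel_measurable M" for t
    using W by (simp add: two_sided_brownian_motion_def)
  have Y: "?Y \<omega> p = F p + s * W p \<omega>" if "- \<eta> \<le> p" "p \<le> 1 + \<eta>" for \<omega> p
    using that by (simp add: white_noise_data_def F_def)
  have Y_meas: "(\<lambda>\<omega>. ?Y \<omega> p) \<in> borel_measurable M" if "- \<eta> \<le> p" "p \<le> 1 + \<eta>" for p
    unfolding Y[OF that] using W_meas by simp
  define G where "G = small_increments M W \<eta> q (jmax + lag)"
  have "G \<subseteq> narrow_cover_event M band ?Y ?r f"
  proof
    fix \<omega> assume \<omega>: "\<omega> \<in> G"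
    have close: "\<bar>estimator D \<eta> j (?Y \<omega>) x - f x\<bar> \<le> Cb * B * 2 powr (- (real j * \<gamma>)) + noise \<nu> j"
      if j: "jmin \<le> j" "j \<le> jmax + lag" and x: "- (CK / 2 ^ jmin) \<le> x" "x \<le> 1 + CK / 2 ^ jmin" for j x
      unfolding Cb \<nu> q_def[symmetric]
    proof (rule estimator_error[OF hol pos(1) _ _ _ F _ \<gamma>(3) A(2), where w = "\<lambda>t. W t \<omega>"])
      show "strict_floor \<gamma> < D" using strict_floor_mono[OF \<gamma>(3)] by (simp add: D)
      have "real D / 2 ^ j \<le> real D / 2 ^ jmin"
        using j by (intro divide_left_mono power_increasing) auto
      then show "{\<lfloor>2 ^ j * x\<rfloor>..\<lfloor>2 ^ j * x\<rfloor> + int D} \<subseteq> obs_grid \<eta> j"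
        using window x D by (intro floor_window_subset_obs_grid[of "CK / 2 ^ jmin"]) (auto simp: add_divide_distrib)
      show "\<bar>W (of_int (i + 1) / 2 ^ j) \<omega> - W (of_int i / 2 ^ j) \<omega>\<bar> \<le> q * 2 powr (- (real j / 2))"
        if "i \<in> obs_grid \<eta> j" for i
        using \<omega> j that unfolding G_def small_increments_def by blast
    qed (use pos s q Y in auto)
    have hw: "halfwidth (?Y \<omega>) \<le> (1 + Cb) * (sqrt 2 * ((2 * C\<^sub>1 * B / \<epsilon>) powr (1 / (2 * \<gamma> + 1))
        * \<nu> powr (2 * \<gamma> / (2 * \<gamma> + 1))))"
      and cover: "(SUP x\<in>{0..1}. ereal \<bar>estimator D \<eta> (level (?Y \<omega>)) (?Y \<omega>) x - f x\<bar>)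
        \<le> ereal (halfwidth (?Y \<omega>))"
      using band_covers[OF less_imp_le[OF pos(5)] pos(3) f jmin(1) \<gamma>(1,2) pos(2) upper lag close C\<^sub>1
          \<open>0 < \<epsilon>\<close> B(1) pos(5) jmin(2) B(2,3) \<gamma>(3) g m0 jmax(2)] by auto
    have "(2 * C\<^sub>1 * B / \<epsilon>) powr (1 / (2 * \<gamma> + 1)) * \<nu> powr (2 * \<gamma> / (2 * \<gamma> + 1))
        \<le> max 1 (2 * C\<^sub>1) * max 1 (?c * sqrt 8) * band_rate s \<gamma> B \<epsilon>"
      unfolding \<nu> using s pos C\<^sub>1 \<open>0 < \<epsilon>\<close> by (intro log_factor_noise_rate) auto
    then have "(1 + Cb) * (sqrt 2 * ((2 * C\<^sub>1 * B / \<epsilon>) powr (1 / (2 * \<gamma> + 1)) * \<nu> powr (2 * \<gamma> / (2 * \<gamma> + 1))))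
        \<le> (1 + Cb) * (sqrt 2 * (max 1 (2 * C\<^sub>1) * max 1 (?c * sqrt 8) * band_rate s \<gamma> B \<epsilon>))"
      using pos by (intro mult_left_mono) auto
    from order_trans[OF hw this] have "2 * halfwidth (?Y \<omega>)
        \<le> 2 * ((1 + Cb) * (sqrt 2 * (max 1 (2 * C\<^sub>1) * max 1 (?c * sqrt 8) * band_rate s \<gamma> B \<epsilon>)))"
      by (rule mult_left_mono) simp
    also have "\<dots> = ?r" by (simp only: mult.assoc)
    finally have "2 * halfwidth (?Y \<omega>) \<le> ?r" .
    with cover \<omega> show "\<omega> \<in> narrow_cover_event M band ?Y ?r f"
      unfolding narrow_cover_event_band[OF less_imp_le[OF pos(5)] pos(3)]
      by (simp add: G_def small_increments_def)
  qed
  \<comment> \<open>Monotonicity of the probability needs the larger event to be measurable.\<close>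
  then have "prob G \<le> prob (narrow_cover_event M band ?Y ?r f)"
    using narrow_cover_event_measurable[OF less_imp_le[OF pos(5)] pos(3) Y_meas]
    by (intro finite_measure_mono) auto
  moreover have "1 - (2 + 2 * \<eta>) * sqrt 2 * exp (- (q\<^sup>2 / 4)) * 2 ^ Suc (jmax + lag) \<le> prob G"
    unfolding G_def using q by (intro small_increments_prob[OF W \<open>\<eta> > 0\<close>]) auto
  \<comment> \<open>The tail is the fourth power of \<open>s\<close>, and \<open>2 ^ jmax\<close>
    consumes two of these powers.\<close>
  moreover have "(2 + 2 * \<eta>) * sqrt 2 * exp (- (q\<^sup>2 / 4)) * 2 ^ Suc (jmax + lag)
      \<le> (2 + 2 * \<eta>) * sqrt 2 * 2 ^ Suc lag * s\<^sup>2"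
  proof -
    have "exp (- (q\<^sup>2 / 4)) = exp (- l) * exp (- l)"
      by (simp add: q exp_add[symmetric])
    also have "exp (- l) = s\<^sup>2"
      using \<open>0 < s\<^sup>2\<close> by (simp add: l_def ln_div)
    finally have e: "exp (- (q\<^sup>2 / 4)) = s\<^sup>2 * s\<^sup>2" .
    have "s\<^sup>2 * 2 ^ jmax \<le> s\<^sup>2 * (1 / s\<^sup>2)"
      unfolding jmax using s by (intro mult_left_mono max_level_bounds) auto
    also have "\<dots> = 1" using s by simp
    finally have "(2 + 2 * \<eta>) * sqrt 2 * 2 ^ Suc lag * s\<^sup>2 * (s\<^sup>2 * 2 ^ jmax)
        \<le> (2 + 2 * \<eta>) * sqrt 2 * 2 ^ Suc lag * s\<^sup>2 * 1"
      using \<open>\<eta> > 0\<close> by (intro mult_left_mono) auto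
    then show ?thesis unfolding e by (simp add: power_add mult_ac)
  qed
  ultimately show ?thesis by linarith
qed

end

theorem theorem2p3:
  fixes K :: "real \<Rightarrow> real \<Rightarrow> real" and \<gamma>up Ct :: real
  assumes kernel: "is_kernel K"
    and supp: "\<exists>CK. \<forall>x y. \<bar>x - y\<bar> > CK \<longrightarrow> K y x = 0"
    and shift: "\<forall>(k::int) x y. K y x = K (y - of_int k) (x - of_int k)"
    and L2: "bdd_above ((\<lambda>t. LINT x|lborel. (K t x)\<^sup>2) ` {0..1})"
    and L2_smooth: "\<exists>\<tau>>0. bdd_above ((\<lambda>(s, t). (LINT x|lborel. (K s x - K t x)\<^sup>2) / \<bar>s - t\<bar> powr \<tau>)
                       ` ({0..1} \<times> {0..1}))"
  shows "\<exists>Cstar :: real. \<forall>\<sigma> \<eta> j0 Blow Bup \<gamma>low :: real.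
    0 < \<sigma> \<longrightarrow> 0 < \<eta> \<longrightarrow> 0 < j0 \<longrightarrow> 0 < Blow \<longrightarrow> Blow < Bup \<longrightarrow> 0 < \<gamma>low \<longrightarrow> \<gamma>low < \<gamma>up \<longrightarrow>
    (\<forall>j::int. \<forall>\<gamma>\<in>{\<gamma>low..\<gamma>up}. \<forall>B\<in>{Blow..Bup}. \<forall>f\<in>holder_class \<gamma> B.
       approx_error K j f \<le> ereal (Ct * B * 2 powr (- (of_int j * \<gamma>)))) \<longrightarrow>
    (\<forall>\<epsilon>>0. \<exists>C :: nat \<Rightarrow> real \<Rightarrow> (real \<Rightarrow> real) \<Rightarrow> real set.
       (\<forall>n. confidence_band \<eta> (C n)) \<and>
       (\<forall>(M :: 'a measure) W. two_sided_brownian_motion M W \<longrightarrow>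
          (\<lambda>n. worst_case_prob M W K j0 \<eta> (noise_level \<sigma> n) {\<gamma>low..\<gamma>up} {Blow..Bup} \<epsilon> Cstar (C n))
            \<longlonglongrightarrow> 1))"
proof -
  obtain CK0 where CK0: "\<And>x y. \<bar>x - y\<bar> > CK0 \<Longrightarrow> K y x = 0" using supp by blast
  obtain L where L: "\<And>t. t \<in> {0..1} \<Longrightarrow> (LINT x|lborel. (K t x)\<^sup>2) \<le> L"
    using L2 unfolding bdd_above_def by blast
  define CK where "CK = max 0 CK0"
  interpret compact_kernel K CK L
    using kernel CK0 L shift by unfold_locales (auto simp: CK_def)
  have band_locale: "adaptive_band K CK L"
    unfolding adaptive_band_def by (rule compact_kernel_axioms)
  define D where "D = strict_floor \<gamma>up + 1"
  obtain A where A: "A > 0" "\<And>i u. \<bar>diff_weight D i u\<bar> \<le> A"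
    by (rule diff_weight_bounded[of D]) (rule that)
  define c where "c = (real D + 1) * A * real D"
  define Cb where "Cb = (real D + 1) * A * real D powr (\<gamma>up + 1)"
  define \<kappa> where "\<kappa> = 1 + L1_bound"
  \<comment> \<open>The absolute value makes the constant positive whatever the sign of
    \<open>Ct\<close>.\<close>
  define C\<^sub>1 where "C\<^sub>1 = 2 * (\<bar>Ct\<bar> + \<kappa> * Cb + 1)"
  \<comment> \<open>All ingredients come from \<open>K\<close>, \<open>\<gamma>up\<close> and
    \<open>Ct\<close>. The parameters \<open>lag\<close>, \<open>g\<close>, \<open>jmin\<close> and
    \<open>m0\<close>, which depend on \<epsilon> and the ranges, are fixed later and only affect
    how large \<open>n\<close> has to be.\<close>
  define Cstar where "Cstar = 2 * (1 + Cb) * sqrt 2 * (max 1 (2 * C\<^sub>1) * max 1 (c * sqrt 8))"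
  have pos: "0 < c" "0 \<le> Cb" "0 < \<kappa>" using A(1) L1_bound_pos by (auto simp: c_def Cb_def \<kappa>_def D_def)
  then have C\<^sub>1: "0 < C\<^sub>1" by (simp add: C\<^sub>1_def add_nonneg_pos)
  show ?thesis
  proof (intro exI[of _ Cstar] allI impI, goal_cases)
    case (1 \<sigma> \<eta> j0 Blow Bup \<gamma>low \<epsilon>)
    note upper = \<open>\<forall>j::int. \<forall>\<gamma>\<in>{\<gamma>low..\<gamma>up}. _\<close>
    \<comment> \<open>\<open>lag\<close> makes the bias of the finer estimator at most half of the
      self-similarity signal.\<close>
    have "(\<lambda>k::nat. \<kappa> * Cb * 2 powr (- (real k * \<gamma>low))) \<longlonglongrightarrow> 0"
      using \<open>0 < \<gamma>low\<close> by real_asymp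
    then have "\<forall>\<^sub>F k in sequentially. \<kappa> * Cb * 2 powr (- (real k * \<gamma>low)) < \<epsilon> / 2"
      using \<open>0 < \<epsilon>\<close> by (intro order_tendstoD(2)) auto
    then obtain lag :: nat where lag: "\<kappa> * Cb * 2 powr (- (real lag * \<gamma>low)) \<le> \<epsilon> / 2"
      by (auto simp: eventually_sequentially intro: less_imp_le)
    \<comment> \<open>\<open>g\<close> is how far below the balancing level the signal stands clear
      of the lagged noise.\<close>
    have "(\<lambda>g::nat. 4 * \<kappa> * C\<^sub>1 / \<epsilon> * 2 powr ((real lag + 1 - real g) / 2)) \<longlonglongrightarrow> 0"
      by real_asymp
    then have "\<forall>\<^sub>F g in sequentially. 4 * \<kappa> * C\<^sub>1 / \<epsilon> * 2 powr ((real lag + 1 - real g) / 2) < 1 \<and> 0 < g"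
      by (intro eventually_conj order_tendstoD(2) eventually_gt_at_top) auto
    then obtain g :: nat where g: "4 * \<kappa> * C\<^sub>1 / \<epsilon> * 2 powr ((real lag + 1 - real g) / 2) \<le> 1" "0 < g"
      by (auto simp: eventually_sequentially intro: less_imp_le)
    have "(\<lambda>j::nat. (CK + real D) / 2 ^ j) \<longlonglongrightarrow> 0" by real_asymp
    then have "\<forall>\<^sub>F j in sequentially. (CK + real D) / 2 ^ j < \<eta> \<and> nat \<lceil>j0\<rceil> + 1 \<le> j"
      using \<open>0 < \<eta>\<close> by (intro eventually_conj order_tendstoD(2) eventually_ge_at_top) auto
    then obtain jmin :: nat where jmin: "(CK + real D) / 2 ^ jmin \<le> \<eta>" "nat \<lceil>j0\<rceil> + 1 \<le> jmin"
      by (auto simp: eventually_sequentially intro: less_imp_le)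
    then have j0: "j0 \<le> real jmin" "0 < jmin" by linarith+
    \<comment> \<open>\<open>m0\<close> is a level beyond which extrapolating over \<open>g\<close>
      levels loses at most a factor 2.\<close>
    have "(\<lambda>m::nat. max 1 (C\<^sub>1 * Bup / (\<epsilon> * Blow)) powr (real g / (real m - real g)))
        \<longlonglongrightarrow> max 1 (C\<^sub>1 * Bup / (\<epsilon> * Blow)) powr 0"
    proof (rule tendsto_powr[OF tendsto_const])
      show "(\<lambda>m::nat. real g / (real m - real g)) \<longlonglongrightarrow> 0" by real_asymp
    qed simp
    then have "\<forall>\<^sub>F m in sequentially.
        max 1 (C\<^sub>1 * Bup / (\<epsilon> * Blow)) powr (real g / (real m - real g)) < 2 \<and> jmin + g \<le> m"
      by (intro eventually_conj order_tendstoD(2) eventually_ge_at_top) auto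
    then obtain m0 :: nat where m0:
      "max 1 (C\<^sub>1 * Bup / (\<epsilon> * Blow)) powr (real g / (real m0 - real g)) \<le> 2" "jmin + g \<le> m0"
      by (auto simp: eventually_sequentially intro: less_imp_le)
    define s where "s = noise_level \<sigma>"
    define \<nu> where "\<nu> n = c * log_factor (s n) * s n" for n
    define C where "C n = adaptive_band.band K CK L D lag jmin (max_level (s n)) \<eta> \<epsilon> Blow (\<nu> n) Cb" for n
    have \<nu>_nonneg: "\<nu> n \<ge> 0" for n
      using pos \<open>0 < \<sigma>\<close> by (simp add: \<nu>_def log_factor_def s_def noise_level_def)
    note lim = noise_level_limits[OF \<open>0 < \<sigma>\<close> pos(1), folded s_def, folded \<nu>_def]
    show ?case
    proof (intro exI[of _ C] conjI allI impI)
      show "confidence_band \<eta> (C n)" for n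
        unfolding C_def by (rule adaptive_band.confidence_band_band[OF band_locale \<nu>_nonneg pos(2)])
    next
      fix M :: "'a measure" and W
      assume W: "two_sided_brownian_motion M W"
      interpret prob_space M using W by (simp add: two_sided_brownian_motion_def)
      let ?p = "\<lambda>n. worst_case_prob M W K j0 \<eta> (noise_level \<sigma> n) {\<gamma>low..\<gamma>up} {Blow..Bup} \<epsilon> Cstar (C n)"
      define S where "S n = {measure M (narrow_cover_event M (C n) (white_noise_data \<eta> (s n) f W)
                                 (Cstar * band_rate (s n) \<gamma> B \<epsilon>) f) | \<gamma> B f.
                    \<gamma> \<in> {\<gamma>low..\<gamma>up} \<and> B \<in> {Blow..Bup} \<and> f \<in> self_similar_class K j0 \<gamma> B \<epsilon>}" for n
      have p: "?p n = Inf (insert 1 (S n))" for n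
        by (simp add: worst_case_prob_def S_def s_def)
      have "\<forall>\<^sub>F n in sequentially. 0 < s n"
        using eventually_gt_at_top[of 0]
        by eventually_elim (simp add: s_def noise_level_def \<open>0 < \<sigma>\<close>)
      moreover have "\<forall>\<^sub>F n in sequentially. s n < 1"
        using lim(1) by (rule order_tendstoD) simp
      moreover have "\<forall>\<^sub>F n in sequentially. noise (\<nu> n) m0 < 2 * C\<^sub>1 * Blow / \<epsilon> * 2 powr (- (real m0 * \<gamma>up))"
      proof (rule order_tendstoD(2))
        show "(\<lambda>n. noise (\<nu> n) m0) \<longlonglongrightarrow> 0"
          unfolding noise_def using lim(2) by (rule tendsto_mult_left_zero)
        show "0 < 2 * C\<^sub>1 * Blow / \<epsilon> * 2 powr (- (real m0 * \<gamma>up))"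
          using C\<^sub>1 \<open>0 < Blow\<close> \<open>0 < \<epsilon>\<close> by simp
      qed
      moreover have "\<forall>\<^sub>F n in sequentially. 2 * C\<^sub>1 * Bup / \<epsilon> \<le> noise (\<nu> n) (max_level (s n))"
        using lim(3) by (simp add: filterlim_at_top)
      moreover have "\<forall>\<^sub>F n in sequentially. m0 \<le> max_level (s n)"
        using lim(4) by (simp add: filterlim_at_top)
      \<comment> \<open>The lower bound is the same for every member of the class, so it passes to
        the infimum; the inserted value 1 satisfies it trivially.\<close>
      ultimately have lower: "\<forall>\<^sub>F n in sequentially. 1 - (2 + 2 * \<eta>) * sqrt 2 * 2 ^ Suc lag * (s n)\<^sup>2 \<le> ?p n"
      proof eventually_elim
        case (elim n)
        show ?case unfolding p
        proof (rule cInf_greatest)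
          fix x assume "x \<in> insert 1 (S n)"
          then consider "x = 1" | "x \<in> S n" by blast
          then show "1 - (2 + 2 * \<eta>) * sqrt 2 * 2 ^ Suc lag * (s n)\<^sup>2 \<le> x"
          proof cases
            case 2
            then obtain \<gamma> B f where x: "x = measure M (narrow_cover_event M (C n)
                (white_noise_data \<eta> (s n) f W) (Cstar * band_rate (s n) \<gamma> B \<epsilon>) f)"
              and *: "\<gamma> \<in> {\<gamma>low..\<gamma>up}" "B \<in> {Blow..Bup}" "f \<in> self_similar_class K j0 \<gamma> B \<epsilon>"
              unfolding S_def by blast
            have upper_f: "approx_error K (int k) f \<le> ereal (Ct * B * 2 powr (- (real k * \<gamma>)))" for k
              using upper[rule_format, of \<gamma> B f "int k"] * by (simp add: self_similar_class_def)
            show ?thesis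
              unfolding x C_def Cstar_def c_def
            proof (rule adaptive_band.narrow_cover_event_prob[OF band_locale W \<open>0 < \<eta>\<close> _ _ D_def A Cb_def
                  _ refl _ jmin(1) *(3) j0 \<open>0 < \<gamma>low\<close> _ _ \<open>0 < Blow\<close> _ _ \<open>0 < \<epsilon>\<close> upper_f
                  lag[unfolded \<kappa>_def] _ C\<^sub>1 g[unfolded \<kappa>_def] m0(2) _ m0(1)])
              show "\<nu> n = (real D + 1) * A * real D * log_factor (s n) * s n"
                by (simp add: \<nu>_def c_def)
              show "2 * (Ct + (1 + L1_bound) * Cb + 1) \<le> C\<^sub>1"
                by (simp add: C\<^sub>1_def \<kappa>_def)
            qed (use * elim in auto)
          qed (use \<open>0 < \<eta>\<close> in simp)
        qed simp
      qed
      show "?p \<longlonglongrightarrow> 1"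
      proof (rule tendsto_sandwich[OF lower _ _ tendsto_const])
        have "(\<lambda>n. 1 - (2 + 2 * \<eta>) * sqrt 2 * 2 ^ Suc lag * (s n)\<^sup>2)
            \<longlonglongrightarrow> 1 - (2 + 2 * \<eta>) * sqrt 2 * 2 ^ Suc lag * 0\<^sup>2"
          by (intro tendsto_intros lim(1))
        then show "(\<lambda>n. 1 - (2 + 2 * \<eta>) * sqrt 2 * 2 ^ Suc lag * (s n)\<^sup>2) \<longlonglongrightarrow> 1" by simp
        have "?p n \<le> 1" for n
          unfolding p by (rule cInf_lower) (auto simp: S_def intro!: bdd_belowI[of _ 0])
        then show "\<forall>\<^sub>F n in sequentially. ?p n \<le> 1" by simp
      qed
    qed
  qed
qed

end
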